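(* Let $p$ be a prime, let $m,n$ be integers with $1\le m\le n\le p-1$, and let $D_p=D(p;m,n)$. Then $D_p$ is strong and the following statements hold. \begin{enumerate} \item[(1)] $\operatorname{diam}(D_p)\le 2p-1$, with equality if and only if $m=n=p-1$. \item[(2)] If $(m,n)\notin\{((p-1)/2,(p-1)/2),\,((p-1)/2,p-1),\,(p-1,p-1)\}$, then $\operatorname{diam}(D_p)\le 120\sqrt{m}+1$. \item[(3)] If $p>(m-1)^3$, then $\operatorname{diam}(D_p)\le 19$. \end{enumerate}
   Context: Let $\mathbb{F}_p$ denote the finite field with $p$ elements. A digraph $D=(V,A)$ has vertex set $V$ and arc set $A\subseteq V\times V$ (loops allowed); an arc $(u,v)\in A$ is written $u\to v$. For integers $1\le m,n\le p-1$, the monomial digraph $D(p;m,n)$ is the digraph with vertex set $\mathbb{F}_p^2=\mathbb{F}_p\times\mathbb{F}_p$ in which there is an arc from $(x_1,x_2)$ to $(y_1,y_2)$ if and only if $x_2+y_2=x_1^m y_1^n$. An $xy$-walk of length $\ell$ is a sequence of vertices $x=z_0\to z_1\to\cdots\to z_\ell=y$ with each consecutive pair an arc; every vertex is reachable from itself (by a walk of length $0$). A digraph is strong (strongly connected) if for every pair of distinct vertices $x,y$ there is a walk from $x$ to $y$ and a walk from $y$ to $x$. The distance $\operatorname{dist}(x,y)$ is the minimum length of an $xy$-walk, or $\infty$ if there is none. The diameter is $\operatorname{diam}(D)=\max\{\operatorname{dist}(x,y): x,y\in V\}$ (over ordered pairs). *)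

theory Defs
  imports
    "Graph_Theory.Graph_Theory"
    "HOL-Number_Theory.Residues"
begin

definition monomial_digraph :: "nat \<Rightarrow> nat \<Rightarrow> nat \<Rightarrow> (int \<times> int) pair_pre_digraph" where
  "monomial_digraph p m n =
    (let F = residue_ring (int p); V = carrier F \<times> carrier F in
      \<lparr> pverts = V,
        parcs = {((x1, x2), (y1, y2)) | x1 x2 y1 y2.
                  (x1, x2) \<in> V \<and> (y1, y2) \<in> V \<and>
                  x2 \<oplus>\<^bsub>F\<^esub> y2 = (x1 [^]\<^bsub>F\<^esub> m) \<otimes>\<^bsub>F\<^esub> (y1 [^]\<^bsub>F\<^esub> n)} \<rparr>)"

lemma wf_monomial_digraph: "pair_wf_digraph (monomial_digraph p m n)"
  by unfold_locales (auto simp: monomial_digraph_def Let_def)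

lemma verts_monomial_digraph:
  "pverts (monomial_digraph p m n) = {0..int p - 1} \<times> {0..int p - 1}"
  by (simp add: monomial_digraph_def residue_ring_def Let_def)

lemma arc_monomial_digraph_iff:
  assumes "1 < p"
    and "(x1, x2) \<in> pverts (monomial_digraph p m n)" "(y1, y2) \<in> pverts (monomial_digraph p m n)"
  shows "((x1, x2), (y1, y2)) \<in> parcs (monomial_digraph p m n) \<longleftrightarrow>
    [x2 + y2 = x1 ^ m * y1 ^ n] (mod int p)"
proof -
  interpret residues "int p" "residue_ring (int p)"
    using assms(1) by unfold_locales auto
  have pow: "x [^]\<^bsub>residue_ring (int p)\<^esub> k = x ^ k mod int p" if "x \<in> {0..int p - 1}" for x and k :: nat
    using pow_cong[of x k] that by simp
  have "x1 \<in> {0..int p - 1}" "y1 \<in> {0..int p - 1}"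
    using assms(2,3) by (auto simp: verts_monomial_digraph)
  then show ?thesis
    using assms(2,3) pow
    by (auto simp: monomial_digraph_def Let_def res_add_eq res_mult_eq cong_def mod_mult_eq)
qed

context wf_digraph
begin

text \<open>With all arc weights equal to 1, the cost of a walk is its length, so the following is the
  least length of a walk, and \<open>\<infinity>\<close> if there is none.\<close>

definition walk_distance :: "'a \<Rightarrow> 'a \<Rightarrow> ereal" where
  "walk_distance u v = \<mu> (\<lambda>_. 1) u v"

definition diameter :: ereal where
  "diameter = (SUP (u, v) \<in> verts G \<times> verts G. walk_distance u v)"

lemma walk_distance_eq: "walk_distance u v = (INF w \<in> {w. awalk u w v}. ereal (real (length w)))"
proof -
  have "awalk_cost (\<lambda>_. 1) w = real (length w)" for w :: "'b awalk"
    by (simp add: awalk_cost_def sum_list_triv)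
  then show ?thesis
    by (simp add: walk_distance_def \<mu>_def)
qed

lemma diameter_eq_Max:
  assumes "finite (verts G)" "verts G \<noteq> {}"
  shows "diameter = Max {walk_distance u v | u v. u \<in> verts G \<and> v \<in> verts G}"
proof -
  have "{walk_distance u v | u v. u \<in> verts G \<and> v \<in> verts G}
      = (\<lambda>(u, v). walk_distance u v) ` (verts G \<times> verts G)"
    by auto
  then show ?thesis
    using assms by (simp add: diameter_def Max_Sup)
qed

end

end

theory Submission
  imports
    Defs
    "HOL-Analysis.Convex"
    "HOL-Number_Theory.Residue_Primitive_Roots"
begin

text \<open>
  Let \<open>H\<close> be the group of all nonzero values \<open>x\<^sup>m y\<^sup>n\<close> modulo \<open>p\<close> and \<open>t\<close> its order, so \<open>m t \<ge> p - 1\<close>.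
  A walk \<open>(0, u) \<rightarrow> (x, -u) \<rightarrow> (y, u + z) \<rightarrow> (0, -u - z)\<close> with \<open>z = x\<^sup>m y\<^sup>n\<close> replaces \<open>u\<close> by \<open>-(u + z)\<close> in three
  steps, a step \<open>(0, u) \<rightarrow> (0, -u)\<close> flips the sign, and every vertex is
  adjacent to and from vertices with first coordinate \<open>0\<close>. Bounding the diameter thus becomes a
  question on sums of few elements of \<open>H \<union> {0}\<close>.

  Cauchy-Davenport yields everything after \<open>m\<close> summands, which gives (1) when \<open>t \<ge> 2\<close> and (3) for
  \<open>m \<le> 5\<close>. For (3) with \<open>m \<ge> 6\<close>, convolution with \<open>H\<close> has operator norm at most \<open>\<surd>p\<close> on functions of
  mean zero (an averaging over dilations replaces Gauss sums), and five summands suffice as soon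
  as \<open>t\<^sup>8 > p\<^sup>5\<close>.

  For (2) let \<open>K = H \<union> -H\<close>. If \<open>K\<close> has at least \<open>15\<close> elements, a ratio-set argument in the style of
  Glibichuk and Konyagin multiplies the size of a sumset by \<open>\<bar>K\<bar>\<close> while the number of summands grows by a
  factor of about \<open>4\<close>; if \<open>K\<close> is smaller, it contains roots of unity generating an imaginary or real
  quadratic order, whose norm form makes a two-dimensional box of sums collision-free. A packing
  argument turns a large set of short sums into a bound on the number of summands for all residues.

  If \<open>m = n = p - 1\<close>, all nonzero products equal \<open>1\<close>, so a unit change of the second coordinate
  costs four steps, which gives diameter exactly \<open>2p - 1\<close>.
\<close>

section \<open>Sumsets modulo a prime\<close>

definition sumset_mod :: "int \<Rightarrow> int set \<Rightarrow> int set \<Rightarrow> int set" where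
  "sumset_mod p A B = (\<lambda>(a, b). (a + b) mod p) ` (A \<times> B)"

lemma sumset_modI: "a \<in> A \<Longrightarrow> b \<in> B \<Longrightarrow> (a + b) mod p \<in> sumset_mod p A B"
  by (force simp: sumset_mod_def)

lemma sumset_modE:
  assumes "x \<in> sumset_mod p A B"
  obtains a b where "a \<in> A" "b \<in> B" "x = (a + b) mod p"
  using assms by (auto simp: sumset_mod_def)

lemma inj_on_residues_affine:
  fixes p c :: int
  assumes "coprime c p"
  shows "inj_on (\<lambda>x. (c * x + e) mod p) {0..<p}"
proof (rule inj_onI)
  fix x y assume xy: "x \<in> {0..<p}" "y \<in> {0..<p}" and "(c * x + e) mod p = (c * y + e) mod p"
  then have "[c * x = c * y] (mod p)"
    by (simp add: cong_def[symmetric] cong_add_rcancel)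
  then have "[x = y] (mod p)"
    using assms cong_mult_lcancel by blast
  then show "x = y" using xy by (simp add: cong_def)
qed

lemma bij_betw_residues_affine:
  fixes p c :: int
  assumes "coprime c p" "p > 0"
  shows "bij_betw (\<lambda>x. (c * x + e) mod p) {0..<p} {0..<p}"
  unfolding bij_betw_def
proof
  show inj: "inj_on (\<lambda>x. (c * x + e) mod p) {0..<p}" using assms(1) by (rule inj_on_residues_affine)
  have "(\<lambda>x. (c * x + e) mod p) ` {0..<p} \<subseteq> {0..<p}" using assms(2) by auto
  then show "(\<lambda>x. (c * x + e) mod p) ` {0..<p} = {0..<p}"
    using inj by (intro endo_inj_surj) auto
qed

lemma coprime_prime_residue: 
  fixes p :: int assumes "prime p" "\<not> p dvd c" shows "coprime c p"
  using prime_imp_coprime[OF assms] by (simp add: coprime_commute)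

text \<open>Starting from one element \<open>a\<close>, the residues \<open>a + k d\<close> exhaust
  everything because \<open>d\<close> is invertible, and stability keeps all of them in
  \<open>A\<close>.\<close>

lemma translation_stable_residues:
  fixes p d :: int
  assumes p: "prime p" and A: "A \<subseteq> {0..<p}" "A \<noteq> {}" and d: "\<not> p dvd d"
    and stable: "\<And>a. a \<in> A \<Longrightarrow> (a + d) mod p \<in> A"
  shows "A = {0..<p}"
proof -
  obtain a where a: "a \<in> A" using A by blast
  have p0: "p > 0" using p by (simp add: prime_gt_0_int)
  have mult: "(a + int k * d) mod p \<in> A" for k
  proof (induction k)
    case 0
    have "a mod p = a" using a A by auto
    then show ?case using a by simp
  next
    case (Suc k)
    have "((a + int k * d) mod p + d) mod p = (a + int (Suc k) * d) mod p"
      by (simp add: algebra_simps mod_simps)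
    then show ?case using stable[OF Suc] by simp
  qed
  have "x \<in> A" if "x \<in> {0..<p}" for x
  proof -
    have "x \<in> (\<lambda>k. (d * k + a) mod p) ` {0..<p}"
      using bij_betw_residues_affine[OF coprime_prime_residue[OF p d] p0, of a] that
      by (auto simp: bij_betw_def)
    then obtain k where "k \<in> {0..<p}" "x = (d * k + a) mod p" by blast
    then show ?thesis using mult[of "nat k"] by (simp add: ac_simps)
  qed
  then show ?thesis using A by blast
qed

text \<open>Induction on the size of \<open>B\<close>: translate \<open>B\<close> to a set
  \<open>B'\<close> that meets \<open>A\<close> without being contained in it, and pass from
  \<open>(A, B)\<close> to \<open>(A \<union> B', A \<inter> B')\<close>. The total size is
  unchanged, the second set shrinks strictly, and the new sumset lies in a translate of
  \<open>A + B\<close>.\<close>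

theorem cauchy_davenport:
  fixes p :: int
  assumes p: "prime p" and "A \<subseteq> {0..<p}" "B \<subseteq> {0..<p}" "A \<noteq> {}" "B \<noteq> {}"
  shows "min (nat p) (card A + card B - 1) \<le> card (sumset_mod p A B)"
  using assms(2-)
proof (induction "card B" arbitrary: A B rule: less_induct)
  case less
  have p0: "p > 0" using p by (simp add: prime_gt_0_int)
  have fin: "finite A" "finite B" using less.prems finite_subset by blast+
  have fS: "finite (sumset_mod p A B)" using fin by (simp add: sumset_mod_def)
  obtain b1 where b1: "b1 \<in> B" using less.prems by blast
  have "card A = card ((\<lambda>a. (1 * a + b1) mod p) ` A)"
    using inj_on_subset[OF inj_on_residues_affine less.prems(1), of 1 b1] by (simp add: card_image)
  also have "\<dots> \<le> card (sumset_mod p A B)"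
    using b1 fS by (intro card_mono) (auto intro: sumset_modI)
  finally have cA: "card A \<le> card (sumset_mod p A B)" .
  show ?case
  proof (cases "B = {b1}")
    case True
    then show ?thesis using cA by simp
  next
    case False
    then obtain b2 where b2: "b2 \<in> B" "b2 \<noteq> b1" using b1 by blast
    have nd: "\<not> p dvd (b2 - b1)"
    proof
      assume "p dvd (b2 - b1)"
      then have "b2 mod p = b1 mod p" by (simp add: mod_eq_dvd_iff)
      then show False using b1 b2 less.prems(2)
        by (metis atLeastLessThan_iff mod_pos_pos_trivial subsetD)
    qed
    show ?thesis
    proof (cases "A = {0..<p}")
      case True
      then show ?thesis using cA p0 by simp
    next
      case False
      \<comment> \<open>The translation that moves \<open>b1\<close> onto this \<open>a\<close>
        carries \<open>b2\<close> outside \<open>A\<close>, so the intersection is nonempty and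
        strictly smaller than \<open>B'\<close>.\<close>
      then obtain a where a: "a \<in> A" "(a + (b2 - b1)) mod p \<notin> A"
        using translation_stable_residues[OF p less.prems(1,3) nd] by blast
      define t where "t = (\<lambda>b. (1 * b + (a - b1)) mod p)"
      define B' where "B' = t ` B"
      have injt: "inj_on t {0..<p}" unfolding t_def by (rule inj_on_residues_affine) simp
      have cB': "card B' = card B" unfolding B'_def
        using injt less.prems(2) by (meson card_image inj_on_subset)
      have B'F: "B' \<subseteq> {0..<p}" using p0 by (auto simp: B'_def t_def)
      have "a = t b1" using a less.prems by (auto simp: t_def)
      then have aB': "a \<in> A \<inter> B'" using a b1 by (auto simp: B'_def)
      have "t b2 \<in> B'" "t b2 \<notin> A" using b2 a by (auto simp: B'_def t_def algebra_simps)
      then have "A \<inter> B' \<subset> B'" by blast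
      moreover have finB': "finite B'" using fin by (simp add: B'_def)
      ultimately have "card (A \<inter> B') < card B'" by (intro psubset_card_mono)
      then have "min (nat p) (card (A \<union> B') + card (A \<inter> B') - 1) \<le> card (sumset_mod p (A \<union> B') (A \<inter> B'))"
        using aB' B'F less.prems(1) cB' by (intro less.hyps) auto
      also have "card (A \<union> B') + card (A \<inter> B') = card A + card B"
        using card_Un_Int[OF fin(1) finB'] cB' by simp
      also have "card (sumset_mod p (A \<union> B') (A \<inter> B')) \<le> card (t ` sumset_mod p A B)"
      proof (rule card_mono)
        show "finite (t ` sumset_mod p A B)" using fS by simp
        have "(a' + t b) mod p = t ((a' + b) mod p)" for a' b
          by (simp add: t_def mod_add_left_eq mod_add_right_eq add.assoc)
        then have *: "(a' + b') mod p \<in> t ` sumset_mod p A B" if "a' \<in> A" "b' \<in> B'" for a' b'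
          using that by (auto simp: B'_def intro!: imageI sumset_modI)
        show "sumset_mod p (A \<union> B') (A \<inter> B') \<subseteq> t ` sumset_mod p A B"
          using * by (auto elim!: sumset_modE) (metis add.commute *)
      qed
      also have "\<dots> \<le> card (sumset_mod p A B)" using fS by (rule card_image_le)
      finally show ?thesis .
    qed
  qed
qed

text \<open>Cauchy-Schwarz over the fibres of \<open>f\<close>: the fibre sizes \<open>c s\<close>
  sum to \<open>card X\<close>, and their squares sum to the number of colliding pairs.\<close>

lemma card_square_le_card_image_collisions:
  fixes f :: "'a \<Rightarrow> 'b"
  assumes fin: "finite X"
  shows "(card X)\<^sup>2 \<le> card (f ` X) * card {q \<in> X \<times> X. f (fst q) = f (snd q)}"
proof -
  define c where "c s = card {x \<in> X. f x = s}" for s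
  have X: "card X = (\<Sum>s\<in>f ` X. c s)"
    unfolding c_def using sum.image_gen[OF fin, of "\<lambda>_. 1::nat" f] by simp
  have "{q \<in> X \<times> X. f (fst q) = f (snd q)} = (\<Union>s\<in>f ` X. {x \<in> X. f x = s} \<times> {x \<in> X. f x = s})"
    by auto
  then have "card {q \<in> X \<times> X. f (fst q) = f (snd q)} = (\<Sum>s\<in>f ` X. card ({x \<in> X. f x = s} \<times> {x \<in> X. f x = s}))"
    using fin by (simp only:, intro card_UN_disjoint) auto
  then have E: "card {q \<in> X \<times> X. f (fst q) = f (snd q)} = (\<Sum>s\<in>f ` X. (c s)\<^sup>2)"
    by (simp add: c_def card_cartesian_product power2_eq_square)
  have "(\<Sum>s\<in>f ` X. real (c s))\<^sup>2 \<le> (\<Sum>s\<in>f ` X. (real (c s))\<^sup>2) * real (card (f ` X))"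
    using Cauchy_Schwarz_ineq_sum[of "\<lambda>s. real (c s)" "\<lambda>_. 1" "f ` X"] by simp
  then have "real ((card X)\<^sup>2) \<le> real (card (f ` X) * card {q \<in> X \<times> X. f (fst q) = f (snd q)})"
    unfolding X E by (simp add: mult.commute)
  then show ?thesis by (simp only: of_nat_le_iff)
qed

text \<open>A pair of points with distinct second coordinates collides for at most one dilation
  factor, so the average number of collisions over all factors is small.\<close>

lemma exists_large_dilate_sum:
  fixes p :: int
  assumes p: "prime p" and A: "A \<subseteq> {0..<p}" and B: "B \<subseteq> {0..<p}"
  shows "\<exists>\<xi>. nat p * (card A * card B)
     \<le> card ((\<lambda>(a, b). (a + \<xi> * b) mod p) ` (A \<times> B)) * (card A * card B + nat p)"
proof -
  have p0: "p > 0" using p by (simp add: prime_gt_0_int)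
  have fin: "finite A" "finite B" using A B finite_subset by blast+
  define n where "n = card A * card B"
  define X where "X = A \<times> B"
  have finX: "finite X" and nX: "card X = n" using fin by (auto simp: X_def n_def card_cartesian_product)
  define g where "g \<xi> = (\<lambda>(a, b). (a + \<xi> * b) mod p)" for \<xi> :: int
  define E where "E \<xi> = {q \<in> X \<times> X. g \<xi> (fst q) = g \<xi> (snd q)}" for \<xi>
  have uniq: "\<xi> = \<xi>'" if "\<xi> \<in> {0..<p}" "\<xi>' \<in> {0..<p}" "x \<in> X" "y \<in> X" "x \<noteq> y"
    "g \<xi> x = g \<xi> y" "g \<xi>' x = g \<xi>' y" for \<xi> \<xi>' x y
  proof -
    obtain a b a' b' where xy: "x = (a, b)" "y = (a', b')" by (metis surj_pair)
    have 1: "p dvd (a + \<xi> * b) - (a' + \<xi> * b')" "p dvd (a + \<xi>' * b) - (a' + \<xi>' * b')"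
      using that(6,7) by (simp_all add: g_def xy mod_eq_dvd_iff)
    then have "p dvd ((a + \<xi> * b) - (a' + \<xi> * b')) - ((a + \<xi>' * b) - (a' + \<xi>' * b'))"
      by (rule dvd_diff)
    also have "((a + \<xi> * b) - (a' + \<xi> * b')) - ((a + \<xi>' * b) - (a' + \<xi>' * b')) = (\<xi> - \<xi>') * (b - b')"
      by (simp add: algebra_simps)
    finally have "p dvd \<xi> - \<xi>' \<or> p dvd b - b'" using p by (simp add: prime_dvd_mult_iff)
    moreover have eq: "u = v" if "p dvd u - v" "u \<in> {0..<p}" "v \<in> {0..<p}" for u v
      using that by (metis atLeastLessThan_iff mod_eq_dvd_iff mod_pos_pos_trivial)
    moreover have "\<not> p dvd b - b'"
    proof
      assume "p dvd b - b'"
      moreover have "b \<in> {0..<p}" "b' \<in> {0..<p}" "a \<in> {0..<p}" "a' \<in> {0..<p}"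
        using that(3,4) A B by (auto simp: xy X_def)
      ultimately have "b = b'" "a = a'" using 1(1) eq[of b b'] eq[of a a'] by auto
      then show False using that(5) xy by simp
    qed
    ultimately show ?thesis using that(1,2) by blast
  qed
  have "\<exists>\<xi>\<in>{0..<p}. nat p * card (E \<xi>) \<le> n * (n + nat p)"
  proof (rule ccontr)
    assume "\<not> ?thesis"
    then have less: "n * (n + nat p) < nat p * card (E \<xi>)" if "\<xi> \<in> {0..<p}" for \<xi> using that by force
    have "(\<Sum>\<xi>\<in>{0..<p}. n * (n + nat p)) < (\<Sum>\<xi>\<in>{0..<p}. nat p * card (E \<xi>))"
      using p0 less by (intro sum_strict_mono) auto
    then have "nat p * (n * (n + nat p)) < nat p * (\<Sum>\<xi>\<in>{0..<p}. card (E \<xi>))"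
      by (simp add: sum_distrib_left)
    then have big: "n * (n + nat p) < (\<Sum>\<xi>\<in>{0..<p}. card (E \<xi>))" by simp
    define C where "C \<xi> = {q \<in> X \<times> X. fst q \<noteq> snd q \<and> g \<xi> (fst q) = g \<xi> (snd q)}" for \<xi>
    have E_le: "card (E \<xi>) \<le> n + card (C \<xi>)" for \<xi>
    proof -
      have "E \<xi> = (\<lambda>x. (x, x)) ` X \<union> C \<xi>" by (auto simp: E_def C_def)
      moreover have "card ((\<lambda>x. (x, x)) ` X) = n" using nX by (simp add: card_image inj_on_def)
      ultimately show ?thesis using card_Un_le[of "(\<lambda>x. (x, x)) ` X" "C \<xi>"] by simp
    qed
    have "(\<Sum>\<xi>\<in>{0..<p}. card (E \<xi>)) \<le> (\<Sum>\<xi>\<in>{0..<p}. n + card (C \<xi>))"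
      by (rule sum_mono) (rule E_le)
    also have "\<dots> = nat p * n + (\<Sum>\<xi>\<in>{0..<p}. card (C \<xi>))"
      by (simp add: sum.distrib)
    also have "(\<Sum>\<xi>\<in>{0..<p}. card (C \<xi>)) = card (\<Union>\<xi>\<in>{0..<p}. C \<xi>)"
    proof (rule card_UN_disjoint[symmetric])
      show "\<forall>\<xi>\<in>{0..<p}. finite (C \<xi>)" using finX by (simp add: C_def)
      show "\<forall>\<xi>\<in>{0..<p}. \<forall>\<xi>'\<in>{0..<p}. \<xi> \<noteq> \<xi>' \<longrightarrow> C \<xi> \<inter> C \<xi>' = {}"
        using uniq by (auto simp: C_def)
    qed simp
    also have "\<dots> \<le> card (X \<times> X)" using finX by (intro card_mono) (auto simp: C_def)
    also have "card (X \<times> X) = n * n" using nX by (simp add: card_cartesian_product)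
    finally show False using big by (simp add: algebra_simps)
  qed
  then obtain \<xi> where \<xi>: "nat p * card (E \<xi>) \<le> n * (n + nat p)" by blast
  have "nat p * n\<^sup>2 \<le> nat p * (card (g \<xi> ` X) * card (E \<xi>))"
    using card_square_le_card_image_collisions[OF finX, of "g \<xi>"] by (simp add: nX E_def)
  also have "\<dots> \<le> card (g \<xi> ` X) * (n * (n + nat p))"
    using mult_le_mono2[OF \<xi>, of "card (g \<xi> ` X)"] by (simp add: ac_simps)
  finally have "n * (nat p * n) \<le> n * (card (g \<xi> ` X) * (n + nat p))"
    by (simp add: power2_eq_square ac_simps)
  then have "nat p * n \<le> card (g \<xi> ` X) * (n + nat p)" by (cases "n = 0") auto
  then show ?thesis by (auto simp: n_def g_def X_def)
qed

text \<open>Subgroups of the unit group modulo \<open>p\<close>, and their sumsets \<open>ksum\<close> below, are represented by their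
  full preimages in the integers.\<close>

locale residue_subgroup =
  fixes p :: int and G :: "int set"
  assumes prime_p: "prime p"
    and one_mem: "1 \<in> G"
    and mult_mem: "x \<in> G \<Longrightarrow> y \<in> G \<Longrightarrow> x * y \<in> G"
    and cong_mem: "x \<in> G \<Longrightarrow> [x = y] (mod p) \<Longrightarrow> y \<in> G"
    and not_dvd: "x \<in> G \<Longrightarrow> \<not> p dvd x"
begin

lemma p_pos: "p > 0" using prime_p by (simp add: prime_gt_0_int)

text \<open>With zero adjoined, sums of exactly \<open>k\<close> elements are sums of at most
  \<open>k\<close> group elements, which makes \<open>ksum\<close> monotone.\<close>

definition G0 :: "int set" where "G0 = {x. x \<in> G \<or> p dvd x}"

lemma cong_mem_G0: "x \<in> G0 \<Longrightarrow> [x = y] (mod p) \<Longrightarrow> y \<in> G0"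
  using cong_mem by (auto simp: G0_def cong_dvd_iff)

lemma mod_mem_iff: "x mod p \<in> G \<longleftrightarrow> x \<in> G"
  using cong_mem[of x "x mod p"] cong_mem[of "x mod p" x] by (auto simp: cong_def)

lemma mult_mem_G0: "x \<in> G0 \<Longrightarrow> y \<in> G0 \<Longrightarrow> x * y \<in> G0"
  using mult_mem by (auto simp: G0_def)

lemma zero_mem_G0: "0 \<in> G0" and one_mem_G0: "1 \<in> G0"
  using one_mem by (auto simp: G0_def)

lemma card_G0: "card (G0 \<inter> {0..<p}) = Suc (card (G \<inter> {0..<p}))"
proof -
  have "G0 \<inter> {0..<p} = insert 0 (G \<inter> {0..<p})"
  proof (rule Set.set_eqI, rule iffI)
    fix x assume x: "x \<in> G0 \<inter> {0..<p}"
    then have "x \<in> G \<or> x = 0" using zdvd_imp_le[of p x] by (fastforce simp: G0_def)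
    then show "x \<in> insert 0 (G \<inter> {0..<p})" using x by blast
  qed (use p_pos in \<open>auto simp: G0_def\<close>)
  moreover have "0 \<notin> G" using not_dvd by fastforce
  ultimately show ?thesis by simp
qed

lemma card_G_pos: "card (G \<inter> {0..<p}) > 0"
  using one_mem prime_gt_1_int[OF prime_p] by (auto simp: card_gt_0_iff intro!: exI[of _ 1])

lemma card_G_le: "int (card (G \<inter> {0..<p})) \<le> p - 1"
proof -
  have "0 \<notin> G" using not_dvd by fastforce
  then have "G \<inter> {0..<p} \<subseteq> {1..<p}" by (auto simp: order_le_less)
  from card_mono[OF _ this] show ?thesis using p_pos by simp
qed

text \<open>Starting from all multiples of \<open>p\<close> instead of only 0 makes every
  \<open>ksum k\<close> a union of residue classes.\<close>

primrec ksum :: "nat \<Rightarrow> int set" where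
  "ksum 0 = {x. p dvd x}"
| "ksum (Suc k) = {y + z | y z. y \<in> ksum k \<and> z \<in> G0}"

declare ksum.simps(2) [simp del]

lemma ksum_SucI: "y \<in> ksum k \<Longrightarrow> z \<in> G0 \<Longrightarrow> y + z \<in> ksum (Suc k)"
  by (auto simp: ksum.simps)

lemma ksum_SucE:
  assumes "x \<in> ksum (Suc k)"
  obtains y z where "x = y + z" "y \<in> ksum k" "z \<in> G0"
  using assms by (auto simp: ksum.simps)

lemma ksum_add: "x \<in> ksum j \<Longrightarrow> y \<in> ksum k \<Longrightarrow> x + y \<in> ksum (j + k)"
proof (induction k arbitrary: y)
  case 0
  have "x + y \<in> ksum j" if "x \<in> ksum j" "p dvd y" for x y j
    using that
  proof (induction j arbitrary: x)
    case (Suc j)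
    obtain u z where "x = u + z" "u \<in> ksum j" "z \<in> G0" using Suc.prems(1) by (rule ksum_SucE)
    then show ?case using ksum_SucI[of "u + y" j z] Suc by (simp add: ac_simps)
  qed simp
  then show ?case using 0 by simp
next
  case (Suc k)
  obtain u z where "y = u + z" "u \<in> ksum k" "z \<in> G0" using Suc.prems(2) by (rule ksum_SucE)
  then show ?case using ksum_SucI[of "x + u" "j + k" z] Suc by (simp add: ac_simps)
qed

lemma ksum_cong: "x \<in> ksum k \<Longrightarrow> [x = y] (mod p) \<Longrightarrow> y \<in> ksum k"
  using ksum_add[of x k "y - x" 0] by (simp add: cong_iff_dvd_diff dvd_diff_commute)

lemma ksum_mod_iff: "x mod p \<in> ksum k \<longleftrightarrow> x \<in> ksum k"
  using ksum_cong[of x k "x mod p"] ksum_cong[of "x mod p" k x] by (auto simp: cong_def)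

lemma zero_mem_ksum: "0 \<in> ksum k"
proof (induction k)
  case (Suc k)
  then show ?case using ksum_SucI[OF _ zero_mem_G0, of 0 k] by simp
qed simp

lemma ksum_mono: "j \<le> k \<Longrightarrow> ksum j \<subseteq> ksum k"
  using ksum_add[of _ j 0 "k - j"] zero_mem_ksum by fastforce

lemma ksum_1: "ksum 1 = G0"
proof
  show "ksum 1 \<subseteq> G0"
  proof
    fix x assume "x \<in> ksum 1"
    then obtain y z where "x = y + z" "p dvd y" "z \<in> G0" by (auto simp: ksum.simps)
    then show "x \<in> G0" using cong_mem_G0[of z x] by (simp add: cong_iff_dvd_diff dvd_diff_commute)
  qed
  show "G0 \<subseteq> ksum 1"
    using ksum_SucI[of 0 0] by auto
qed

lemma G0_mult_ksum: "h \<in> G0 \<Longrightarrow> x \<in> ksum k \<Longrightarrow> h * x \<in> ksum k"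
proof (induction k arbitrary: x)
  case (Suc k)
  obtain u z where "x = u + z" "u \<in> ksum k" "z \<in> G0" using Suc.prems(2) by (rule ksum_SucE)
  then show ?case
    using ksum_SucI[of "h * u" k "h * z"] Suc mult_mem_G0 by (simp add: distrib_left)
qed simp

text \<open>Each summand of \<open>x\<close> multiplies \<open>y\<close> into \<open>ksum k\<close>
  again, because \<open>G0\<close> is closed under products; there are \<open>j\<close> such
  summands.\<close>

lemma ksum_mult: "x \<in> ksum j \<Longrightarrow> y \<in> ksum k \<Longrightarrow> x * y \<in> ksum (j * k)"
proof (induction j arbitrary: x)
  case 0
  then have "[0 = x * y] (mod p)" by (simp add: cong_iff_dvd_diff)
  then show ?case using ksum_cong[OF zero_mem_ksum, of "x * y" "0 * k"] by blast
next
  case (Suc j)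
  obtain u z where "x = u + z" "u \<in> ksum j" "z \<in> G0" using Suc.prems(1) by (rule ksum_SucE)
  then have "z * y + u * y \<in> ksum (k + j * k)" using Suc G0_mult_ksum by (intro ksum_add) auto
  then show ?case using \<open>x = u + z\<close> by (simp add: algebra_simps)
qed

lemma nat_mem_ksum: "int k \<in> ksum k"
proof (induction k)
  case (Suc k)
  then show ?case using ksum_SucI[OF Suc one_mem_G0] by (simp add: add.commute)
qed simp

lemma ksum_eventually_UNIV: "ksum (nat p) = UNIV"
proof -
  have "x \<in> ksum (nat p)" for x
  proof -
    have "x mod p \<in> ksum (nat (x mod p))" using nat_mem_ksum[of "nat (x mod p)"] p_pos by simp
    moreover have "nat (x mod p) \<le> nat p" using p_pos by (simp add: nat_mono less_imp_le)
    ultimately show ?thesis using ksum_mono ksum_mod_iff by blast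
  qed
  then show ?thesis by blast
qed

text \<open>Once two consecutive sumsets agree, the sequence is constant from there on, yet it
  reaches all integers.\<close>

lemma ksum_sphere_nonempty:
  assumes "ksum k \<noteq> UNIV"
  shows "ksum (Suc k) - ksum k \<noteq> {}"
proof
  assume "ksum (Suc k) - ksum k = {}"
  then have stable: "ksum (Suc k) = ksum k" using ksum_mono[of k "Suc k"] by auto
  have "ksum (k + j) = ksum k" for j
  proof (induction j)
    case (Suc j)
    then have "ksum (k + Suc j) = ksum (Suc k)" by (simp add: ksum.simps(2))
    then show ?case using stable by simp
  qed simp
  from this[of "nat p"] have "ksum k = UNIV"
    using ksum_mono[of "nat p" "k + nat p"] ksum_eventually_UNIV by auto
  then show False using assms by simp
qed

end

section \<open>Symmetric subgroups and packing of translates\<close>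

locale symmetric_residue_subgroup = residue_subgroup +
  assumes neg_mem: "x \<in> G \<Longrightarrow> - x \<in> G"
begin

lemma neg_mem_G0: "x \<in> G0 \<Longrightarrow> - x \<in> G0"
  using neg_mem by (auto simp: G0_def)

lemma neg_mem_ksum: "x \<in> ksum k \<Longrightarrow> - x \<in> ksum k"
proof (induction k arbitrary: x)
  case (Suc k)
  obtain u z where "x = u + z" "u \<in> ksum k" "z \<in> G0" using Suc.prems by (rule ksum_SucE)
  then show ?case using ksum_SucI[of "- u" k "- z"] Suc neg_mem_G0 by simp
qed simp

lemma int_mem_ksum: "z \<in> ksum (nat \<bar>z\<bar>)"
  using nat_mem_ksum[of "nat \<bar>z\<bar>"] neg_mem_ksum[of "int (nat \<bar>z\<bar>)" "nat \<bar>z\<bar>"] by (cases "z \<ge> 0") auto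

text \<open>Choosing points of word length \<open>0\<close>, \<open>2k + 1\<close>, \<open>2 (2k + 1)\<close>, \<dots> gives pairwise disjoint
  translates of \<open>A\<close>.\<close>

lemma ksum_packing:
  assumes A: "A \<subseteq> {0..<p}" "A \<noteq> {}" "A \<subseteq> ksum k"
  shows "ksum ((2 * k + 1) * (nat p div card A)) = UNIV"
proof -
  have finA: "finite A" using A finite_subset by blast
  define s where "s = 2 * k + 1"
  have count: "Suc j * card A \<le> card (ksum (j * s + k) \<inter> {0..<p})" if "j = 0 \<or> ksum (j * s - 1) \<noteq> UNIV" for j
    using that
  proof (induction j)
    case 0
    show ?case using A ksum_mono[of k k] by (auto intro!: card_mono)
  next
    case (Suc j)
    have "ksum (Suc j * s - 1) \<noteq> UNIV" using Suc.prems by simp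
    moreover have "ksum (j * s - 1) \<subseteq> ksum (Suc j * s - 1)"
      by (intro ksum_mono diff_le_mono) simp
    ultimately have "ksum (j * s - 1) \<noteq> UNIV" by blast
    then have IH: "Suc j * card A \<le> card (ksum (j * s + k) \<inter> {0..<p})" using Suc.IH by blast
    obtain c where c: "c \<in> ksum (Suc j * s)" "c \<notin> ksum (Suc j * s - 1)"
      using ksum_sphere_nonempty[OF \<open>ksum (Suc j * s - 1) \<noteq> UNIV\<close>] by (auto simp: s_def)
    define A' where "A' = (\<lambda>a. (1 * a + c) mod p) ` A"
    have cA': "card A' = card A" unfolding A'_def
      using inj_on_subset[OF inj_on_residues_affine A(1), of 1 c] by (simp add: card_image)
    \<comment> \<open>The point \<open>c\<close> has word length exactly \<open>Suc j * s\<close>.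
      If \<open>a + c\<close> had length at most \<open>j * s + k\<close>, then subtracting
      \<open>a\<close> would give \<open>c\<close> length at most \<open>j * s + 2 * k\<close>,
      which is one less than \<open>Suc j * s\<close>.\<close>
    have disj: "A' \<inter> (ksum (j * s + k) \<inter> {0..<p}) = {}"
    proof -
      have False if "a \<in> A" "(a + c) mod p \<in> ksum (j * s + k)" for a
      proof -
        have "a + c \<in> ksum (j * s + k)" using that by (simp add: ksum_mod_iff)
        then have "(a + c) + - a \<in> ksum (j * s + k + k)"
          using that A(3) neg_mem_ksum by (intro ksum_add[of "a + c"]) auto
        moreover have "Suc j * s - 1 = j * s + k + k" by (simp add: s_def)
        ultimately show False using c by simp
      qed
      then show ?thesis by (auto simp: A'_def)
    qed
    have sub: "A' \<union> (ksum (j * s + k) \<inter> {0..<p}) \<subseteq> ksum (Suc j * s + k) \<inter> {0..<p}"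
    proof -
      have "(a + c) mod p \<in> ksum (Suc j * s + k)" if "a \<in> A" for a
        using ksum_add[OF c(1), of a k] that A by (auto simp: ksum_mod_iff add.commute)
      moreover have "ksum (j * s + k) \<subseteq> ksum (Suc j * s + k)" by (rule ksum_mono) simp
      ultimately show ?thesis using p_pos by (auto simp: A'_def)
    qed
    have "Suc (Suc j) * card A \<le> card A' + card (ksum (j * s + k) \<inter> {0..<p})" using IH cA' by simp
    also have "\<dots> = card (A' \<union> (ksum (j * s + k) \<inter> {0..<p}))"
      using disj finA by (subst card_Un_disjoint) (auto simp: A'_def)
    also have "\<dots> \<le> card (ksum (Suc j * s + k) \<inter> {0..<p})" using sub by (intro card_mono) auto
    finally show ?case .
  qed
  define j where "j = nat p div card A"
  have A0: "card A > 0" using A finA by (simp add: card_gt_0_iff)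
  have "card A \<le> nat p" using card_mono[OF _ A(1)] by simp
  then have j0: "j \<noteq> 0" using A0 by (simp add: j_def div_eq_0_iff)
  \<comment> \<open>More than \<open>p\<close> residues would be needed for \<open>j + 1\<close>
    disjoint translates, so the premise of \<open>count\<close> fails at this \<open>j\<close>.
    Since \<open>j\<close> is nonzero, the failing alternative is the one about
    \<open>ksum\<close>.\<close>
  have "nat p < Suc j * card A" using A0 dividend_less_times_div[of "card A" "nat p"] by (simp add: j_def ac_simps)
  moreover have "card (ksum (j * s + k) \<inter> {0..<p}) \<le> nat p"
    using card_mono[of "{0..<p}" "ksum (j * s + k) \<inter> {0..<p}"] by simp
  ultimately have "ksum (j * s - 1) = UNIV" using count[of j] by force
  then have "ksum (j * s) = UNIV" using ksum_mono[of "j * s - 1" "j * s"] by auto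
  then show ?thesis by (simp add: j_def s_def mult.commute)
qed

end

section \<open>Growth of sumsets of multiplicative subgroups\<close>

text \<open>Chooses the number \<open>i\<close> of growth steps: the first factor will be
  \<open>2 * k + 1\<close> for the word length \<open>k\<close> reached, the second a bound for the
  inverse density. For the least \<open>i\<close> with \<open>z / 4 \<le> (b / 4) ^ i\<close> the
  quotient is at most \<open>4 * z\<close> after rescaling, and minimality together with
  \<open>b / 4 \<ge> 4\<close> keeps \<open>4 ^ i\<close> below \<open>z\<close> unless
  \<open>i = 0\<close>.\<close>

lemma exists_growth_exponent:
  fixes b z :: real
  assumes b: "b \<ge> 16" and z: "z \<ge> 1"
  shows "\<exists>i. (10 * 4 ^ i - 1) / 3 * (z\<^sup>2 / b ^ i + 2) \<le> 30 * z - 1 / 4"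
proof -
  have "\<exists>i. z / 4 < (b / 4) ^ i" using b by (intro real_arch_pow) simp
  then have ex: "\<exists>i. z / 4 \<le> (b / 4) ^ i" using less_imp_le by blast
  define i where "i = (LEAST i. z / 4 \<le> (b / 4) ^ i)"
  have i: "z / 4 \<le> (b / 4) ^ i" unfolding i_def using ex by (rule LeastI_ex)
  have "(10 * 4 ^ i - 1) / 3 * (z\<^sup>2 / b ^ i + 2) \<le> 10 / 3 * 4 ^ i * (z\<^sup>2 / b ^ i + 2)"
    using b by (intro mult_right_mono) (auto simp: field_simps)
  also have "\<dots> = 10 / 3 * (z\<^sup>2 / (b / 4) ^ i + 2 * 4 ^ i)"
    using b by (simp add: power_divide field_simps)
  also have "\<dots> \<le> 30 * z - 1 / 4"
  proof (cases i)
    case 0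
    then have "(z - 1) * (4 - z) \<ge> 0" using i z by simp
    then have "z\<^sup>2 \<le> 5 * z - 4" by (simp add: power2_eq_square algebra_simps)
    then show ?thesis using 0 z i by simp
  next
    case (Suc j)
    have "\<not> z / 4 \<le> (b / 4) ^ j"
      using not_less_Least[of j "\<lambda>i. z / 4 \<le> (b / 4) ^ i"] Suc by (simp add: i_def)
    moreover have "(4::real) ^ j \<le> (b / 4) ^ j" using b by (intro power_mono) auto
    ultimately have "(4::real) ^ i \<le> z" using Suc by simp
    moreover have "z\<^sup>2 / (b / 4) ^ i \<le> 4 * z"
    proof -
      have "z\<^sup>2 / (b / 4) ^ i \<le> z\<^sup>2 / (z / 4)"
        using i z b by (intro divide_left_mono mult_pos_pos) auto
      also have "\<dots> = 4 * z" using z by (simp add: power2_eq_square)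
      finally show ?thesis .
    qed
    ultimately show ?thesis using z by argo
  qed
  finally show ?thesis by (rule exI[of _ i])
qed

context symmetric_residue_subgroup
begin

text \<open>Let \<open>R\<close> be the set of ratios \<open>(a - a') / (\<beta> - \<beta>')\<close>. If \<open>R\<close> is everything, the averaging
  lemma above supplies \<open>\<xi>\<close>. Otherwise some \<open>r \<in> R\<close> has \<open>r + 1 \<notin> R\<close>, and then
  \<open>(a, b) \<mapsto> a + (r + 1) b\<close> is injective on \<open>A \<times> B\<close>. In both cases \<open>\<xi>\<close> is a quotient of short sums,
  so that \<open>A + \<xi> B\<close> can be rescaled into a short sumset.\<close>

lemma exists_dilation_growth:
  assumes A: "A \<subseteq> {0..<p}" "A \<noteq> {}" "A \<subseteq> ksum k"
  defines "B \<equiv> G0 \<inter> {0..<p}"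
  obtains \<xi> \<beta> \<beta>' \<eta> where "\<beta> \<in> B" "\<beta>' \<in> B" "\<beta> \<noteq> \<beta>'" "\<eta> \<in> ksum (2 * k + 2)" "[\<xi> * (\<beta> - \<beta>') = \<eta>] (mod p)"
    "nat p * (card A * card B)
      \<le> card ((\<lambda>(a, b). (a + \<xi> * b) mod p) ` (A \<times> B)) * (card A * card B + nat p)"
proof -
  define R where "R = {\<xi>. \<exists>a\<in>A. \<exists>a'\<in>A. \<exists>\<beta>\<in>B. \<exists>\<beta>'\<in>B. \<beta> \<noteq> \<beta>' \<and> [\<xi> * (\<beta> - \<beta>') = a - a'] (mod p)}"
  have p1: "p > 1" using prime_p by (simp add: prime_gt_1_int)
  have B: "B \<subseteq> {0..<p}" "0 \<in> B" "1 \<in> B" using zero_mem_G0 one_mem_G0 p1 by (auto simp: B_def)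
  have eqI: "x = y" if "x \<in> {0..<p}" "y \<in> {0..<p}" "[x = y] (mod p)" for x y
    using that by (auto simp: cong_def)
  have diffA: "a - a' \<in> ksum (2 * k)" if "a \<in> A" "a' \<in> A" for a a'
    using that A(3) ksum_add[of a k "- a'" k] neg_mem_ksum by (auto simp: mult_2)
  show thesis
  proof (cases "R = UNIV")
    case True
    obtain \<xi> where \<xi>: "nat p * (card A * card B)
      \<le> card ((\<lambda>(a, b). (a + \<xi> * b) mod p) ` (A \<times> B)) * (card A * card B + nat p)"
      using exists_large_dilate_sum[OF prime_p A(1) B(1)] by blast
    obtain a a' \<beta> \<beta>' where *: "a \<in> A" "a' \<in> A" "\<beta> \<in> B" "\<beta>' \<in> B" "\<beta> \<noteq> \<beta>'" "[\<xi> * (\<beta> - \<beta>') = a - a'] (mod p)"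
      using UNIV_I[of \<xi>] unfolding True[symmetric] R_def by blast
    have "a - a' \<in> ksum (2 * k + 2)" using diffA[OF *(1,2)] ksum_mono[of "2 * k" "2 * k + 2"] by auto
    then show thesis using *(6) \<xi> by (rule that[OF *(3-5)])
  next
    case False
    then obtain \<xi>0 where \<xi>0: "\<xi>0 \<notin> R" by blast
    have R_cong: "y \<in> R" if xR: "x \<in> R" and xy: "[x = y] (mod p)" for x y
    proof -
      obtain a a' \<beta> \<beta>' where *: "a \<in> A" "a' \<in> A" "\<beta> \<in> B" "\<beta>' \<in> B" "\<beta> \<noteq> \<beta>'" "[x * (\<beta> - \<beta>') = a - a'] (mod p)"
        using xR unfolding R_def by blast
      moreover have "[y * (\<beta> - \<beta>') = x * (\<beta> - \<beta>')] (mod p)"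
        using xy by (intro cong_mult) (auto simp: cong_sym)
      ultimately have "[y * (\<beta> - \<beta>') = a - a'] (mod p)" using cong_trans by blast
      then show ?thesis using * by (auto simp: R_def)
    qed
    have R0: "0 \<in> R"
    proof -
      obtain a where "a \<in> A" using A(2) by blast
      moreover have "(0::int) \<noteq> 1" by simp
      ultimately show ?thesis unfolding R_def using B(2,3) by (simp, metis cong_refl diff_self)
    qed
    \<comment> \<open>Otherwise \<open>R\<close>, which contains 0, would be closed under adding 1
      and hence contain every residue.\<close>
    have "\<exists>r. r \<in> R \<and> r + 1 \<notin> R"
    proof (rule ccontr)
      assume *: "\<nexists>r. r \<in> R \<and> r + 1 \<notin> R"
      have "int j \<in> R" for j
      proof (induction j)
        case (Suc j)
        then have "int j + 1 \<in> R" using * by blast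
        then show ?case by (simp add: add.commute)
      qed (use R0 in simp)
      from this[of "nat (\<xi>0 mod p)"] have "\<xi>0 mod p \<in> R" using p_pos by simp
      then have "\<xi>0 \<in> R" by (rule R_cong) (simp add: cong_def)
      then show False using \<xi>0 by simp
    qed
    then obtain r where r: "r \<in> R" "r + 1 \<notin> R" by blast
    obtain a a' \<beta> \<beta>' where *: "a \<in> A" "a' \<in> A" "\<beta> \<in> B" "\<beta>' \<in> B" "\<beta> \<noteq> \<beta>'" "[r * (\<beta> - \<beta>') = a - a'] (mod p)"
      using r(1) unfolding R_def by blast
    \<comment> \<open>Adding 1 to the ratio adds \<open>\<beta> - \<beta>'\<close> to the numerator;
      this is the source of the \<open>+ 2\<close> in the word length.\<close>
    define \<eta> where "\<eta> = (a - a') + (\<beta> - \<beta>')"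
    have "\<beta> - \<beta>' \<in> ksum (1 + 1)"
      using *(3,4) ksum_add[of \<beta> 1 "- \<beta>'" 1] neg_mem_G0 unfolding ksum_1 by (auto simp: B_def)
    then have \<eta>: "\<eta> \<in> ksum (2 * k + 2)"
      using ksum_add[OF diffA[OF *(1,2)], of "\<beta> - \<beta>'" 2] by (simp add: \<eta>_def numeral_2_eq_2)
    have \<xi>\<eta>: "[(r + 1) * (\<beta> - \<beta>') = \<eta>] (mod p)"
      using cong_add[OF *(6) cong_refl, of "\<beta> - \<beta>'"] by (simp add: \<eta>_def algebra_simps)
    \<comment> \<open>A collision with \<open>b \<noteq> b'\<close> would exhibit
      \<open>r + 1\<close> as a ratio.\<close>
    have "inj_on (\<lambda>(a, b). (a + (r + 1) * b) mod p) (A \<times> B)"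
    proof (rule inj_onI, clarify)
      fix a b a' b' assume ab: "a \<in> A" "b \<in> B" "a' \<in> A" "b' \<in> B"
        and "(a + (r + 1) * b) mod p = (a' + (r + 1) * b') mod p"
      then have d: "p dvd (a + (r + 1) * b) - (a' + (r + 1) * b')" by (simp add: mod_eq_dvd_iff)
      have "(r + 1) * (b - b') - (a' - a) = (a + (r + 1) * b) - (a' + (r + 1) * b')"
        by (simp add: algebra_simps)
      then have "[(r + 1) * (b - b') = a' - a] (mod p)" using d by (simp only: cong_iff_dvd_diff)
      then have "b = b'" using r(2) ab by (auto simp: R_def)
      moreover then have "[a = a'] (mod p)" using d by (simp add: cong_iff_dvd_diff)
      ultimately show "a = a' \<and> b = b'" using ab A(1) eqI by blast
    qed
    then have "card ((\<lambda>(a, b). (a + (r + 1) * b) mod p) ` (A \<times> B)) = card A * card B"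
      by (simp add: card_image card_cartesian_product)
    then have "nat p * (card A * card B)
      \<le> card ((\<lambda>(a, b). (a + (r + 1) * b) mod p) ` (A \<times> B)) * (card A * card B + nat p)"
      by (simp add: algebra_simps)
    then show thesis by (rule that[OF *(3-5) \<eta> \<xi>\<eta>])
  qed
qed

text \<open>Multiplication by the unit \<open>\<beta> - \<beta>'\<close> preserves the size of
  \<open>A + \<xi> B\<close> and turns \<open>a + \<xi> b\<close> into
  \<open>\<beta> a - \<beta>' a + b \<eta>\<close>, of word length at most
  \<open>k + k + (2 * k + 2)\<close>.\<close>

lemma ksum_growth_step:
  assumes A: "A \<subseteq> {0..<p}" "A \<noteq> {}" "A \<subseteq> ksum k"
  shows "\<exists>A'. A' \<subseteq> {0..<p} \<and> A' \<noteq> {} \<and> A' \<subseteq> ksum (4 * k + 2) \<and>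
    nat p * (card A * card (G0 \<inter> {0..<p})) \<le> card A' * (card A * card (G0 \<inter> {0..<p}) + nat p)"
proof -
  define B where "B = G0 \<inter> {0..<p}"
  obtain \<xi> \<beta> \<beta>' \<eta> where *: "\<beta> \<in> B" "\<beta>' \<in> B" "\<beta> \<noteq> \<beta>'" "\<eta> \<in> ksum (2 * k + 2)" "[\<xi> * (\<beta> - \<beta>') = \<eta>] (mod p)"
    and large: "nat p * (card A * card B)
      \<le> card ((\<lambda>(a, b). (a + \<xi> * b) mod p) ` (A \<times> B)) * (card A * card B + nat p)"
    unfolding B_def by (rule exists_dilation_growth[OF A])
  define S where "S = (\<lambda>(a, b). (a + \<xi> * b) mod p) ` (A \<times> B)"
  define A' where "A' = (\<lambda>x. ((\<beta> - \<beta>') * x + 0) mod p) ` S"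
  have "\<not> p dvd \<beta> - \<beta>'"
  proof
    assume "p dvd \<beta> - \<beta>'"
    then have "\<beta> mod p = \<beta>' mod p" by (simp add: mod_eq_dvd_iff)
    then show False using *(1-3) by (simp add: B_def)
  qed
  then have "inj_on (\<lambda>x. ((\<beta> - \<beta>') * x + 0) mod p) {0..<p}"
    using prime_p by (intro inj_on_residues_affine coprime_prime_residue)
  moreover have "S \<subseteq> {0..<p}" using p_pos by (auto simp: S_def)
  ultimately have "card A' = card S" unfolding A'_def by (meson card_image inj_on_subset)
  moreover have "A' \<subseteq> ksum (4 * k + 2)"
  proof -
    have "((\<beta> - \<beta>') * ((a + \<xi> * b) mod p) + 0) mod p \<in> ksum (4 * k + 2)" if "a \<in> A" "b \<in> B" for a b
    proof -
      have 1: "\<beta> * a \<in> ksum k" "\<beta>' * a \<in> ksum k" using that *(1,2) A(3) G0_mult_ksum by (auto simp: B_def)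
      have "b * \<eta> \<in> ksum (2 * k + 2)" using that *(4) G0_mult_ksum by (auto simp: B_def)
      then have 2: "(\<beta> * a + - (\<beta>' * a)) + b * \<eta> \<in> ksum ((k + k) + (2 * k + 2))"
        using 1 neg_mem_ksum by (intro ksum_add[of "\<beta> * a + - (\<beta>' * a)"] ksum_add[of "\<beta> * a"]) auto
      have "[b * (\<xi> * (\<beta> - \<beta>')) = b * \<eta>] (mod p)" using *(5) by (rule cong_scalar_left)
      then have "[(\<beta> * a + - (\<beta>' * a)) + b * \<eta> = (\<beta> * a + - (\<beta>' * a)) + b * (\<xi> * (\<beta> - \<beta>'))] (mod p)"
        by (intro cong_add cong_refl) (rule cong_sym)
      also have "(\<beta> * a + - (\<beta>' * a)) + b * (\<xi> * (\<beta> - \<beta>')) = (\<beta> - \<beta>') * (a + \<xi> * b)"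
        by (simp add: algebra_simps)
      finally have "(\<beta> - \<beta>') * (a + \<xi> * b) \<in> ksum ((k + k) + (2 * k + 2))" using 2 ksum_cong by blast
      moreover have "(k + k) + (2 * k + 2) = 4 * k + 2" by simp
      ultimately show ?thesis by (simp add: ksum_mod_iff mod_mult_right_eq)
    qed
    then show ?thesis by (auto simp: A'_def S_def)
  qed
  moreover have "A' \<noteq> {}" using A(2) *(1) by (auto simp: A'_def S_def)
  moreover have "A' \<subseteq> {0..<p}" using p_pos by (auto simp: A'_def)
  ultimately show ?thesis using large unfolding B_def[symmetric] S_def by (intro exI[of _ A']) simp
qed

text \<open>Iterating \<open>k \<mapsto> 4 * k + 2\<close> from 1 yields
  \<open>3 * k + 2 = 5 * 4 ^ i\<close>. In terms of inverse densities a step divides by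
  \<open>b\<close> and adds 1, and the error 2 reproduces itself because
  \<open>2 / b + 1 \<le> 2\<close>.\<close>

lemma ksum_growth:
  defines "b \<equiv> card (G0 \<inter> {0..<p})"
  shows "\<exists>A k. A \<subseteq> {0..<p} \<and> A \<noteq> {} \<and> A \<subseteq> ksum k \<and> 3 * k + 2 = 5 * 4 ^ i \<and>
    real_of_int p / card A \<le> real_of_int p / real b ^ Suc i + 2"
proof (induction i)
  case 0
  have "0 \<in> G0 \<inter> {0..<p}" using zero_mem_G0 p_pos by simp
  then have "G0 \<inter> {0..<p} \<noteq> {}" by blast
  moreover have "G0 \<inter> {0..<p} \<subseteq> ksum 1" unfolding ksum_1 by simp
  ultimately show ?case unfolding b_def
    by (intro exI[of _ "G0 \<inter> {0..<p}"] exI[of _ 1]) simp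
next
  case (Suc i)
  then obtain A k where A: "A \<subseteq> {0..<p}" "A \<noteq> {}" "A \<subseteq> ksum k" and k: "3 * k + 2 = 5 * 4 ^ i"
    and size: "real_of_int p / card A \<le> real_of_int p / real b ^ Suc i + 2" by blast
  obtain A' where A': "A' \<subseteq> {0..<p}" "A' \<noteq> {}" "A' \<subseteq> ksum (4 * k + 2)"
    and le: "nat p * (card A * b) \<le> card A' * (card A * b + nat p)"
    using ksum_growth_step[OF A] by (auto simp: b_def)
  have b2: "b \<ge> 2"
  proof -
    have "{0, 1} \<subseteq> G0 \<inter> {0..<p}" using zero_mem_G0 one_mem_G0 prime_gt_1_int[OF prime_p] by auto
    from card_mono[OF _ this] show ?thesis by (simp add: b_def)
  qed
  have pos: "card A > 0" "card A' > 0" using A A' finite_subset[OF A(1)] finite_subset[OF A'(1)] by (auto simp: card_gt_0_iff)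
  have "real (nat p * (card A * b)) \<le> real (card A' * (card A * b + nat p))" using le by (simp only: of_nat_le_iff)
  then have "real_of_int p * (card A * b) \<le> card A' * (card A * b + real_of_int p)" using p_pos by simp
  then have "real_of_int p / card A' \<le> (real_of_int p / card A) / b + 1"
    using pos b2 by (simp add: field_simps)
  also have "\<dots> \<le> (real_of_int p / real b ^ Suc i + 2) / b + 1"
    using size b2 by (intro add_right_mono divide_right_mono) auto
  also have "\<dots> = real_of_int p / real b ^ Suc (Suc i) + 2 / b + 1" using b2 by (simp add: field_simps)
  also have "2 / real b \<le> 1" using b2 by simp
  finally have "real_of_int p / card A' \<le> real_of_int p / real b ^ Suc (Suc i) + 2" by simp
  moreover have "3 * (4 * k + 2) + 2 = 5 * 4 ^ Suc i" using k by simp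
  ultimately show ?case using A' by blast
qed

lemma ksum_packing_real:
  assumes A: "A \<subseteq> {0..<p}" "A \<noteq> {}" "A \<subseteq> ksum k"
  obtains L where "ksum L = UNIV" "real L \<le> (2 * real k + 1) * (real_of_int p / card A)"
proof
  show "ksum ((2 * k + 1) * (nat p div card A)) = UNIV" using A by (rule ksum_packing)
  have "real (nat p div card A) \<le> real (nat p) / card A" by (rule of_nat_div_le_of_nat)
  then have "real (nat p div card A) \<le> real_of_int p / card A" using p_pos by simp
  then have "(2 * real k + 1) * real (nat p div card A) \<le> (2 * real k + 1) * (real_of_int p / card A)"
    by (rule mult_left_mono) simp
  then show "real ((2 * k + 1) * (nat p div card A)) \<le> (2 * real k + 1) * (real_of_int p / card A)"
    by (simp add: algebra_simps)
qed

text \<open>Growth followed by packing. Order at least 15 makes the growth factor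
  \<open>Suc \<tau>\<close> at least 16, and the exponent is chosen with \<open>z = sqrt D\<close>,
  where \<open>D\<close> is the index.\<close>

lemma ksum_UNIV_large_order:
  assumes "card (G \<inter> {0..<p}) \<ge> 15"
  obtains L where "ksum L = UNIV"
    "real L \<le> 30 * sqrt (real_of_int (p - 1) / card (G \<inter> {0..<p})) - 1 / 4"
proof -
  define \<tau> where "\<tau> = card (G \<inter> {0..<p})"
  define D where "D = real_of_int (p - 1) / \<tau>"
  have D1: "D \<ge> 1" using card_G_le assms by (simp add: D_def \<tau>_def field_simps)
  have "\<tau> > 0" using card_G_pos by (simp only: \<tau>_def)
  then have D: "D * \<tau> = real_of_int p - 1" by (simp add: D_def)
  obtain i where i: "(10 * 4 ^ i - 1) / 3 * ((sqrt D)\<^sup>2 / real (Suc \<tau>) ^ i + 2) \<le> 30 * sqrt D - 1 / 4"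
    using exists_growth_exponent[of "real (Suc \<tau>)" "sqrt D"] assms D1 by (auto simp: \<tau>_def)
  obtain A k where A: "A \<subseteq> {0..<p}" "A \<noteq> {}" "A \<subseteq> ksum k" and k: "3 * k + 2 = 5 * 4 ^ i"
    and size: "real_of_int p / card A \<le> real_of_int p / real (Suc \<tau>) ^ Suc i + 2"
    using ksum_growth[of i] unfolding card_G0 \<tau>_def by blast
  obtain L where L: "ksum L = UNIV" "real L \<le> (2 * real k + 1) * (real_of_int p / card A)"
    using ksum_packing_real[OF A] by blast
  have "real (3 * k + 2) = real (5 * 4 ^ i)" using k by (simp only:)
  then have k': "2 * real k + 1 = (10 * 4 ^ i - 1) / 3" by simp
  have "real_of_int p / real (Suc \<tau>) \<le> D" using D D1 by (simp add: field_simps)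
  then have "real_of_int p / real (Suc \<tau>) / real (Suc \<tau>) ^ i \<le> D / real (Suc \<tau>) ^ i"
    by (rule divide_right_mono) simp
  then have "real_of_int p / real (Suc \<tau>) ^ Suc i \<le> D / real (Suc \<tau>) ^ i"
    by (simp add: field_simps)
  then have "real_of_int p / card A \<le> (sqrt D)\<^sup>2 / real (Suc \<tau>) ^ i + 2" using size D1 by simp
  then have "(2 * real k + 1) * (real_of_int p / card A)
      \<le> (10 * 4 ^ i - 1) / 3 * ((sqrt D)\<^sup>2 / real (Suc \<tau>) ^ i + 2)"
    unfolding k' by (rule mult_left_mono) (simp add: order.trans[OF one_le_power[of "4::real" i]])
  then have "real L \<le> 30 * sqrt D - 1 / 4" using L(2) i by linarith
  then show ?thesis using L(1) that by (simp add: D_def \<tau>_def)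
qed

text \<open>Packing translates of \<open>G0\<close> itself gives the linear bound
  \<open>3 * D\<close>, which stays below the square-root bound while
  \<open>sqrt D \<le> 9.95\<close>; the square of 9.95 is just above 99.\<close>

lemma ksum_UNIV_small_index:
  assumes "real_of_int (p - 1) / card (G \<inter> {0..<p}) \<le> 99"
  obtains L where "ksum L = UNIV"
    "real L \<le> 30 * sqrt (real_of_int (p - 1) / card (G \<inter> {0..<p})) - 1 / 4"
proof -
  define \<tau> where "\<tau> = card (G \<inter> {0..<p})"
  define D where "D = real_of_int (p - 1) / \<tau>"
  have \<tau>0: "\<tau> > 0" using card_G_pos by (simp add: \<tau>_def)
  have D1: "D \<ge> 1" using card_G_le \<tau>0 by (simp add: D_def \<tau>_def field_simps)
  have D: "D * \<tau> = real_of_int p - 1" using \<tau>0 by (simp add: D_def)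
  have "0 \<in> G0 \<inter> {0..<p}" using zero_mem_G0 p_pos by simp
  then have "G0 \<inter> {0..<p} \<noteq> {}" by blast
  moreover have "G0 \<inter> {0..<p} \<subseteq> ksum 1" unfolding ksum_1 by simp
  ultimately obtain L where L: "ksum L = UNIV" "real L \<le> (2 * real 1 + 1) * (real_of_int p / card (G0 \<inter> {0..<p}))"
    using ksum_packing_real[of "G0 \<inter> {0..<p}" 1] by blast
  have "real_of_int p / real (Suc \<tau>) \<le> D" using D D1 by (simp add: field_simps)
  then have "real L \<le> 3 * D" using L(2) unfolding card_G0 \<tau>_def by simp
  moreover have "3 * D \<le> 30 * sqrt D - 1 / 4"
  proof -
    define z where "z = sqrt D"
    have z: "z \<ge> 1" "D = z\<^sup>2" using D1 by (auto simp: z_def)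
    have "z \<le> 9.95"
    proof (rule ccontr)
      assume "\<not> z \<le> 9.95"
      then have "9.95\<^sup>2 < z\<^sup>2" by (intro power_strict_mono) auto
      then show False using assms z by (simp add: D_def \<tau>_def power2_eq_square)
    qed
    then have "(z - 1) * (9.95 - z) \<ge> 0" using z by simp
    moreover have "(z - 1) * (9.95 - z) = 10.95 * z - 9.95 - z\<^sup>2" by (simp add: power2_eq_square field_simps)
    ultimately have "z\<^sup>2 \<le> 10.95 * z - 9.95" by linarith
    then have "3 * z\<^sup>2 \<le> 30 * z - 1 / 4" using \<open>z \<le> 9.95\<close> by (simp add: field_simps)
    then have "3 * D \<le> 30 * z - 1 / 4" by (simp only: z(2))
    then show ?thesis unfolding z_def .
  qed
  ultimately show ?thesis using L(1) that by (simp add: D_def \<tau>_def)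
qed

end

section \<open>Subgroups of small order\<close>

lemma int_primitive_root:
  fixes p :: int
  assumes "prime p"
  obtains g :: int where "\<not> p dvd g" "\<And>i. [g ^ i = 1] (mod p) \<longleftrightarrow> nat (p - 1) dvd i"
    "\<And>x. \<not> p dvd x \<Longrightarrow> \<exists>i. [x = g ^ i] (mod p)"
proof -
  define q where "q = nat p"
  have p: "p = int q" using prime_gt_0_int[OF assms] by (simp add: q_def)
  have q: "prime q" using assms unfolding p by simp
  obtain g where g: "residue_primroot q g" using prime_primitive_root_exists[of q] q prime_gt_1_nat[OF q] by auto
  have tot: "totient q = nat (p - 1)" using q p by (simp add: totient_prime nat_diff_distrib')
  have ord: "ord q g = nat (p - 1)" and cop: "coprime q g" using g tot by (auto simp: residue_primroot_def)
  show ?thesis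
  proof (rule that[of "int g"])
    show "\<not> p dvd int g"
    proof
      assume "p dvd int g"
      then have "q dvd g" using p by simp
      then show False using cop q by (metis coprime_absorb_left not_prime_unit)
    qed
    show "[int g ^ i = 1] (mod p) \<longleftrightarrow> nat (p - 1) dvd i" for i
      using ord_divides[of g i q] cong_int_iff[of "g ^ i" 1 q] ord p by simp
    show "\<exists>i. [x = int g ^ i] (mod p)" if "\<not> p dvd x" for x
    proof -
      define y where "y = nat (x mod p)"
      have y: "int y = x mod p" using prime_gt_0_int[OF assms] by (simp add: y_def)
      have "y < q" using y p prime_gt_0_int[OF assms] pos_mod_bound[of p x] by linarith
      moreover have y0: "y \<noteq> 0" using y that by (auto simp: dvd_eq_mod_eq_0)
      moreover have "\<not> q dvd y" using \<open>y < q\<close> y0 by (simp add: nat_dvd_not_less)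
      then have "coprime y q" using q by (simp add: prime_imp_coprime coprime_commute)
      ultimately have "y \<in> totatives q" by (simp add: in_totatives_iff)
      then obtain i where "y = g ^ i mod q"
        using residue_primroot_is_generator[OF prime_gt_1_nat[OF q] g] by (auto simp: bij_betw_def)
      then have "int y = int g ^ i mod p" using p by (simp add: zmod_int)
      then show ?thesis using y by (auto simp: cong_def)
    qed
  qed
qed

text \<open>Infinite descent: the form is odd unless both arguments are even, so a nonzero solution
  could be halved forever.\<close>

lemma golden_form_nonzero:
  fixes a b :: int
  assumes "a\<^sup>2 - a * b - b\<^sup>2 = 0"
  shows "a = 0 \<and> b = 0"
  using assms
proof (induction "nat (\<bar>a\<bar> + \<bar>b\<bar>)" arbitrary: a b rule: less_induct)
  case less
  have "even (a\<^sup>2 - a * b - b\<^sup>2)" using less.prems by simp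
  then have "even a" "even b" by auto
  then obtain c d where cd: "a = 2 * c" "b = 2 * d" by (auto elim!: evenE)
  then have eq: "c\<^sup>2 - c * d - d\<^sup>2 = 0" using less.prems by (simp add: power2_eq_square)
  show ?case
  proof (rule ccontr)
    assume nz: "\<not> (a = 0 \<and> b = 0)"
    then have "nat (\<bar>c\<bar> + \<bar>d\<bar>) < nat (\<bar>a\<bar> + \<bar>b\<bar>)" using cd by auto
    from less.hyps[OF this eq] show False using nz cd by simp
  qed
qed

text \<open>Four times the form is a sum of two nonnegative terms after completing the
  square.\<close>

lemma definite_form_nonzero:
  fixes a b c d :: int
  assumes "a\<^sup>2 - c * a * b + d * b\<^sup>2 = 0" "4 * d > c\<^sup>2"
  shows "a = 0 \<and> b = 0"
proof -
  have "(2 * a - c * b)\<^sup>2 + (4 * d - c\<^sup>2) * b\<^sup>2 = 4 * (a\<^sup>2 - c * a * b + d * b\<^sup>2)"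
    by (simp add: power2_eq_square algebra_simps)
  then have "(2 * a - c * b)\<^sup>2 + (4 * d - c\<^sup>2) * b\<^sup>2 = 0" using assms(1) by simp
  moreover have "(4 * d - c\<^sup>2) * b\<^sup>2 \<ge> 0" using assms(2) by (intro mult_nonneg_nonneg) auto
  ultimately have "(2 * a - c * b)\<^sup>2 = 0" "(4 * d - c\<^sup>2) * b\<^sup>2 = 0"
    by (smt (verit) zero_le_power2)+
  then show ?thesis using assms(2) by auto
qed

section \<open>Cyclicity of the subgroup\<close>

context residue_subgroup
begin

lemma power_mem: "x \<in> G \<Longrightarrow> x ^ i \<in> G"
  by (induction i) (auto simp: one_mem mult_mem)

text \<open>With \<open>g\<close> a primitive root and \<open>D\<close> the least positive exponent
  for which \<open>g ^ D\<close> lies in \<open>G\<close>, the generator is \<open>g ^ D\<close>: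
  division with remainder shows that \<open>D\<close> divides every exponent occurring in
  \<open>G\<close>.\<close>

lemma generator:
  obtains \<omega> where "\<omega> \<in> G" "\<And>i. [\<omega> ^ i = 1] (mod p) \<longleftrightarrow> card (G \<inter> {0..<p}) dvd i"
    "\<And>x. x \<in> G \<Longrightarrow> \<exists>i. [x = \<omega> ^ i] (mod p)"
proof -
  obtain g where g: "\<not> p dvd g" "\<And>i. [g ^ i = 1] (mod p) \<longleftrightarrow> nat (p - 1) dvd i"
    "\<And>x. \<not> p dvd x \<Longrightarrow> \<exists>i. [x = g ^ i] (mod p)"
    using int_primitive_root[OF prime_p] by blast
  define N where "N = nat (p - 1)"
  have N0: "N > 0" using prime_gt_1_int[OF prime_p] by (simp add: N_def)
  have gN: "[g ^ (N * j) = 1] (mod p)" for j using g(2) by (simp add: N_def)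
  define D where "D = (LEAST i. i > 0 \<and> g ^ i \<in> G)"
  have "g ^ N \<in> G" using cong_mem[OF one_mem] gN[of 1] by (simp add: cong_sym)
  then have D: "D > 0" "g ^ D \<in> G"
    using LeastI[of "\<lambda>i. i > 0 \<and> g ^ i \<in> G" N] N0 by (auto simp: D_def)
  have Ddvd: "D dvd i" if i: "g ^ i \<in> G" for i
  proof (rule ccontr)
    assume nd: "\<not> D dvd i"
    define q where "q = i div D"
    \<comment> \<open>The inverse of \<open>g ^ (D * q)\<close> is written as the power with
      exponent \<open>D * q * (N - 1)\<close>, since \<open>g ^ N\<close> is congruent to 1; this
      reduces \<open>i\<close> to \<open>i mod D\<close> without leaving \<open>G\<close>.\<close>
    have "g ^ (i + D * (q * (N - 1))) \<in> G"
      using mult_mem[OF i power_mem[OF D(2), of "q * (N - 1)"]] by (simp add: power_add power_mult)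
    also have "i + D * (q * (N - 1)) = i mod D + N * (D * q)"
    proof -
      have "i = i mod D + D * q" by (simp add: q_def)
      then have "i + D * (q * (N - 1)) = i mod D + (D * q + D * q * (N - 1))" by simp
      also have "D * q + D * q * (N - 1) = D * q * Suc (N - 1)" by simp
      finally show ?thesis using N0 by (simp add: mult.commute)
    qed
    finally have "g ^ (i mod D) * g ^ (N * (D * q)) \<in> G" by (simp add: power_add)
    then have "g ^ (i mod D) \<in> G"
      by (rule cong_mem) (use cong_mult[OF cong_refl gN[of "D * q"], of "g ^ (i mod D)"] in simp)
    moreover have "i mod D > 0" using nd by (simp add: mod_greater_zero_iff_not_dvd)
    ultimately have "D \<le> i mod D" unfolding D_def by (intro Least_le) simp
    then show False using mod_less_divisor[OF D(1), of i] by linarith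
  qed
  define n where "n = N div D"
  have "D dvd N" by (rule Ddvd) fact
  then have n: "N = D * n" by (simp add: n_def)
  define \<omega> where "\<omega> = g ^ D"
  have ord: "[\<omega> ^ i = 1] (mod p) \<longleftrightarrow> n dvd i" for i
    using g(2)[of "D * i"] D(1) n by (simp add: \<omega>_def power_mult[symmetric] N_def[symmetric])
  have gen: "\<exists>i. [x = \<omega> ^ i] (mod p)" if x: "x \<in> G" for x
  proof -
    obtain i where i: "[x = g ^ i] (mod p)" using g(3) not_dvd x by blast
    then have "g ^ i \<in> G" using x cong_mem by blast
    then obtain j where "i = D * j" using Ddvd by blast
    then show ?thesis using i by (auto simp: \<omega>_def power_mult)
  qed
  have n0: "n > 0" using N0 n by (cases n) auto
  have wG: "\<omega> ^ i \<in> G" for i using D(2) power_mem by (simp add: \<omega>_def)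
  have "G \<inter> {0..<p} = (\<lambda>i. \<omega> ^ i mod p) ` {..<n}"
  proof
    show "(\<lambda>i. \<omega> ^ i mod p) ` {..<n} \<subseteq> G \<inter> {0..<p}" using wG mod_mem_iff p_pos by auto
    show "G \<inter> {0..<p} \<subseteq> (\<lambda>i. \<omega> ^ i mod p) ` {..<n}"
    proof
      fix x assume x: "x \<in> G \<inter> {0..<p}"
      then obtain i where i: "[x = \<omega> ^ i] (mod p)" using gen by blast
      have "\<omega> ^ i = \<omega> ^ (i mod n) * \<omega> ^ (n * (i div n))" by (simp add: power_add[symmetric])
      moreover have "[\<omega> ^ (n * (i div n)) = 1] (mod p)" using ord by simp
      ultimately have "[\<omega> ^ i = \<omega> ^ (i mod n) * 1] (mod p)" by (metis cong_mult cong_refl)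
      then have "x mod p = \<omega> ^ (i mod n) mod p" using i by (simp add: cong_def)
      moreover have "x mod p = x" using x by simp
      ultimately show "x \<in> (\<lambda>i. \<omega> ^ i mod p) ` {..<n}" using n0 by auto
    qed
  qed
  moreover have "inj_on (\<lambda>i. \<omega> ^ i mod p) {..<n}"
  proof (rule linorder_inj_onI')
    fix i j assume ij: "i \<in> {..<n}" "j \<in> {..<n}" "i < j"
    show "\<omega> ^ i mod p \<noteq> \<omega> ^ j mod p"
    proof
      assume "\<omega> ^ i mod p = \<omega> ^ j mod p"
      moreover have "\<omega> ^ j = \<omega> ^ i * \<omega> ^ (j - i)" using ij by (simp add: power_add[symmetric])
      ultimately have "[\<omega> ^ i * \<omega> ^ (j - i) = \<omega> ^ i * 1] (mod p)" by (simp add: cong_def)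
      moreover have "coprime (\<omega> ^ i) p"
        using coprime_prime_residue[OF prime_p] not_dvd wG by blast
      ultimately have "[\<omega> ^ (j - i) = 1] (mod p)" using cong_mult_lcancel by blast
      then have "n dvd j - i" using ord by simp
      then show False using ij by (auto dest: dvd_imp_le)
    qed
  qed
  ultimately have "card (G \<inter> {0..<p}) = n" by (simp add: card_image)
  then show ?thesis using that[of \<omega>] ord gen wG[of 1] by simp
qed

lemma power_card_cong_1:
  assumes "x \<in> G"
  shows "[x ^ card (G \<inter> {0..<p}) = 1] (mod p)"
proof -
  obtain \<omega> where \<omega>: "\<omega> \<in> G" "\<And>i. [\<omega> ^ i = 1] (mod p) \<longleftrightarrow> card (G \<inter> {0..<p}) dvd i"
    "\<And>x. x \<in> G \<Longrightarrow> \<exists>i. [x = \<omega> ^ i] (mod p)" using generator by blast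
  obtain i where "[x = \<omega> ^ i] (mod p)" using \<omega>(3) assms by blast
  then have "[x ^ card (G \<inter> {0..<p}) = (\<omega> ^ i) ^ card (G \<inter> {0..<p})] (mod p)" by (rule cong_pow)
  also have "[(\<omega> ^ i) ^ card (G \<inter> {0..<p}) = 1] (mod p)"
    using \<omega>(2) by (simp add: power_mult[symmetric])
  finally show ?thesis .
qed

end

context symmetric_residue_subgroup
begin

lemma even_card_G:
  assumes "p \<noteq> 2"
  shows "even (card (G \<inter> {0..<p}))"
proof (rule ccontr)
  assume odd: "odd (card (G \<inter> {0..<p}))"
  have "[(-1) ^ card (G \<inter> {0..<p}) = 1] (mod p)"
    using power_card_cong_1[OF neg_mem[OF one_mem]] by simp
  then have "p dvd 2" using odd by (simp add: cong_iff_dvd_diff)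
  then have "p \<le> 2" by (rule zdvd_imp_le) simp
  then show False using assms prime_gt_1_int[OF prime_p] by simp
qed

text \<open>The box \<open>{a + b u}\<close> with \<open>\<bar>a\<bar> \<le> 2M\<close>, \<open>\<bar>b\<bar> \<le> M\<close> is free of collisions because the norm form
  of a colliding difference is a multiple of \<open>p\<close> of absolute value at most \<open>32 M\<^sup>2 < p\<close>.\<close>

lemma ksum_UNIV_quadratic:
  fixes c d u :: int
  assumes u: "u \<in> ksum 3" "p dvd u\<^sup>2 + c * u + d" and c: "\<bar>c\<bar> \<le> 1" and d: "\<bar>d\<bar> \<le> 2"
    and form: "\<And>a b :: int. a\<^sup>2 - c * a * b + d * b\<^sup>2 = 0 \<Longrightarrow> a = 0 \<and> b = 0"
    and p: "p \<ge> 398" and order: "card (G \<inter> {0..<p}) \<le> 14"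
  obtains L where "ksum L = UNIV"
    "real L \<le> 30 * sqrt (real_of_int (p - 1) / card (G \<inter> {0..<p})) - 1 / 4"
proof -
  \<comment> \<open>That is, \<open>M\<close> is the largest number with
    \<open>32 * M\<^sup>2 < p\<close>.\<close>
  define M where "M = (LEAST M. p \<le> 32 * (int M + 1)\<^sup>2)"
  have "p \<le> 32 * (int (nat p) + 1)\<^sup>2" using p by (simp add: power2_eq_square algebra_simps)
  then have M_up: "p \<le> 32 * (int M + 1)\<^sup>2" unfolding M_def by (rule LeastI)
  have M3: "M \<ge> 3"
  proof (rule ccontr)
    assume "\<not> M \<ge> 3"
    then have "(int M + 1)\<^sup>2 \<le> 3\<^sup>2" by (intro power_mono) auto
    then show False using M_up p by simp
  qed
  have M_low: "32 * (int M)\<^sup>2 < p"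
  proof -
    have "\<not> p \<le> 32 * (int (M - 1) + 1)\<^sup>2"
      using M3 not_less_Least[of "M - 1" "\<lambda>M. p \<le> 32 * (int M + 1)\<^sup>2"] by (auto simp: M_def)
    then show ?thesis using M3 by (simp add: of_nat_diff)
  qed
  define X where "X = {- (2 * int M)..2 * int M} \<times> {- int M..int M}"
  define f where "f = (\<lambda>(a, b). (a + b * u) mod p)"
  have inj: "inj_on f X"
  proof (rule inj_onI, clarify)
    fix a b a' b' assume ab: "(a, b) \<in> X" "(a', b') \<in> X" and eq: "f (a, b) = f (a', b')"
    define x y where "x = a - a'" and "y = b - b'"
    have "p dvd (a + b * u) - (a' + b' * u)" using eq by (simp add: f_def mod_eq_dvd_iff)
    also have "(a + b * u) - (a' + b' * u) = x + y * u" by (simp add: x_def y_def algebra_simps)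
    \<comment> \<open>Multiplying by the conjugate \<open>x - y * u - c * y\<close> and using the
      quadratic congruence for \<open>u\<close> produces the norm form.\<close>
    finally have "p dvd (x + y * u) * (x - y * u - c * y) + y\<^sup>2 * (u\<^sup>2 + c * u + d)"
      using u(2) by (intro dvd_add) auto
    also have "(x + y * u) * (x - y * u - c * y) + y\<^sup>2 * (u\<^sup>2 + c * u + d) = x\<^sup>2 - c * x * y + d * y\<^sup>2"
      by (simp add: power2_eq_square algebra_simps)
    finally have dvd: "p dvd x\<^sup>2 - c * x * y + d * y\<^sup>2" .
    have xy: "\<bar>x\<bar> \<le> 4 * int M" "\<bar>y\<bar> \<le> 2 * int M" using ab by (auto simp: X_def x_def y_def)
    have "\<bar>x\<^sup>2 - c * x * y + d * y\<^sup>2\<bar> \<le> \<bar>x\<^sup>2\<bar> + \<bar>c * x * y\<bar> + \<bar>d * y\<^sup>2\<bar>" by linarith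
    also have "\<dots> = \<bar>x\<bar>\<^sup>2 + \<bar>c\<bar> * (\<bar>x\<bar> * \<bar>y\<bar>) + \<bar>d\<bar> * \<bar>y\<bar>\<^sup>2" by (simp add: abs_mult)
    also have "\<dots> \<le> (4 * int M)\<^sup>2 + 1 * (4 * int M * (2 * int M)) + 2 * (2 * int M)\<^sup>2"
      using xy c d by (intro add_mono mult_mono power_mono) auto
    also have "\<dots> = 32 * (int M)\<^sup>2" by (simp add: power2_eq_square)
    finally have "\<bar>x\<^sup>2 - c * x * y + d * y\<^sup>2\<bar> < p" using M_low by linarith
    then have "x\<^sup>2 - c * x * y + d * y\<^sup>2 = 0" using dvd dvd_imp_le_int[of "x\<^sup>2 - c * x * y + d * y\<^sup>2" p] p_pos by fastforce
    then have "x = 0 \<and> y = 0" by (rule form)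
    then show "a = a' \<and> b = b'" by (simp add: x_def y_def)
  qed
  define A where "A = f ` X"
  have cA: "card A = (4 * M + 1) * (2 * M + 1)"
  proof -
    have "card A = card X" using inj by (simp add: A_def card_image)
    also have "\<dots> = nat (4 * int M + 1) * nat (2 * int M + 1)" by (simp add: X_def card_cartesian_product)
    also have "nat (4 * int M + 1) = 4 * M + 1" by simp
    also have "nat (2 * int M + 1) = 2 * M + 1" by simp
    finally show ?thesis .
  qed
  have "A \<subseteq> {0..<p}" using p_pos by (auto simp: A_def f_def)
  moreover have "A \<noteq> {}" using cA by auto
  moreover have "A \<subseteq> ksum (5 * M)"
  proof -
    have "a + b * u \<in> ksum (5 * M)" if "(a, b) \<in> X" for a b
    proof -
      \<comment> \<open>The word length is at most \<open>2 * M + 3 * M\<close>, as \<open>u\<close>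
        itself costs three summands.\<close>
      have "a + b * u \<in> ksum (nat \<bar>a\<bar> + nat \<bar>b\<bar> * 3)"
        using int_mem_ksum u(1) by (intro ksum_add ksum_mult)
      moreover have "nat \<bar>a\<bar> + nat \<bar>b\<bar> * 3 \<le> 5 * M" using that by (auto simp: X_def)
      ultimately show ?thesis using ksum_mono by blast
    qed
    then show ?thesis by (auto simp: A_def f_def ksum_mod_iff)
  qed
  ultimately obtain L where L: "ksum L = UNIV" "real L \<le> (2 * real (5 * M) + 1) * (real_of_int p / card A)"
    using ksum_packing_real by blast
  define m s where "m = real M" and "s = sqrt (real_of_int p)"
  have "19.9\<^sup>2 \<le> real_of_int p" using p by (simp add: power2_eq_square)
  then have s2: "19.9 \<le> s" unfolding s_def by (rule real_le_rsqrt)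
  have s1: "s\<^sup>2 = real_of_int p" using p by (simp add: s_def)
  note s = s1 s2
  have m3: "m \<ge> 3" using M3 by (simp add: m_def)
  have "s \<le> sqrt 32 * (m + 1)"
  proof -
    have "real_of_int p \<le> real_of_int (32 * (int M + 1)\<^sup>2)" using M_up by (simp only: of_int_le_iff)
    then have "s \<le> sqrt (32 * (m + 1)\<^sup>2)" by (simp add: s_def m_def)
    then show ?thesis using m3 by (simp add: real_sqrt_mult)
  qed
  also have "sqrt 32 * (m + 1) \<le> 5.657 * (m + 1)"
    using m3 by (intro mult_right_mono real_le_lsqrt) (auto simp: power2_eq_square)
  finally have s_up: "s / (m + 1) \<le> 5.657" using m3 by (simp add: field_simps)
  have "(10 * m + 1) / ((4 * m + 1) * (2 * m + 1)) \<le> 15 / 11 / (m + 1)"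
  proof -
    define X Y where "X = (4 * m + 1) * (2 * m + 1)" and "Y = 10 * m + 1"
    have "15 * X - 11 * (Y * (m + 1)) = (m - 3) * (10 * m - 1) + 1"
      by (simp add: X_def Y_def algebra_simps)
    moreover have "(m - 3) * (10 * m - 1) \<ge> 0" using m3 by simp
    ultimately have "11 * (Y * (m + 1)) \<le> 15 * X" by linarith
    moreover have "X > 0" using m3 by (simp add: X_def)
    ultimately have "Y / X \<le> 15 / 11 / (m + 1)" using m3 by (simp add: field_simps)
    then show ?thesis by (simp only: X_def Y_def)
  qed
  then have "(10 * m + 1) / ((4 * m + 1) * (2 * m + 1)) * s\<^sup>2 \<le> 15 / 11 / (m + 1) * s\<^sup>2"
    by (rule mult_right_mono) simp
  also have "15 / 11 / (m + 1) * s\<^sup>2 = 15 / 11 * s * (s / (m + 1))" by (simp add: power2_eq_square)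
  also have "\<dots> \<le> 15 / 11 * s * 5.657" using s_up s(2) by (intro mult_left_mono) auto
  \<comment> \<open>The factor 0.266 lies above \<open>15 / 11 * 5.657 / 30\<close> and just below
    \<open>1 / sqrt 14\<close>, where 14 is the bound on the order.\<close>
  also have "\<dots> \<le> 30 * (0.266 * s) - 1 / 4" using s(2) by simp
  also have "0.266 * s \<le> sqrt (real_of_int (p - 1) / card (G \<inter> {0..<p}))"
  proof (rule real_le_rsqrt)
    have "(0.266 * s)\<^sup>2 = 0.070756 * real_of_int p" unfolding s(1)[symmetric] by (simp add: power2_eq_square)
    also have "\<dots> \<le> real_of_int (p - 1) / 14" using p by simp
    also have "\<dots> \<le> real_of_int (p - 1) / card (G \<inter> {0..<p})"
    proof (rule divide_left_mono)
      have "real (card (G \<inter> {0..<p})) > 0" using card_G_pos by (simp only: of_nat_0_less_iff)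
      then show "0 < 14 * real (card (G \<inter> {0..<p}))" by simp
    qed (use p order in auto)
    finally show "(0.266 * s)\<^sup>2 \<le> real_of_int (p - 1) / card (G \<inter> {0..<p})" .
  qed
  finally have bound: "(10 * m + 1) / ((4 * m + 1) * (2 * m + 1)) * s\<^sup>2
      \<le> 30 * sqrt (real_of_int (p - 1) / card (G \<inter> {0..<p})) - 1 / 4" by simp
  have "(2 * real (5 * M) + 1) * (real_of_int p / card A) = (10 * m + 1) / ((4 * m + 1) * (2 * m + 1)) * s\<^sup>2"
  proof -
    have "real (card A) = (4 * m + 1) * (2 * m + 1)" unfolding cA m_def of_nat_mult by (simp add: add.commute)
    then show ?thesis unfolding s(1) by (simp add: m_def)
  qed
  then show ?thesis using that[of L] L bound by simp
qed

text \<open>The order is even and at most \<open>14\<close>, hence divisible by \<open>3\<close>, \<open>4\<close>, \<open>5\<close> or \<open>7\<close>, and the corresponding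
  roots of unity have quadratic Gaussian periods.\<close>

lemma ksum_UNIV_small_order:
  assumes p: "p \<ge> 398" and order: "card (G \<inter> {0..<p}) \<ge> 3" "card (G \<inter> {0..<p}) \<le> 14"
  obtains L where "ksum L = UNIV"
    "real L \<le> 30 * sqrt (real_of_int (p - 1) / card (G \<inter> {0..<p})) - 1 / 4"
proof -
  define \<tau> where "\<tau> = card (G \<inter> {0..<p})"
  obtain \<omega> where \<omega>: "\<omega> \<in> G" "\<And>i. [\<omega> ^ i = 1] (mod p) \<longleftrightarrow> \<tau> dvd i"
    using generator unfolding \<tau>_def by metis
  define P where "P \<longleftrightarrow> (\<exists>L. ksum L = UNIV \<and> real L \<le> 30 * sqrt (real_of_int (p - 1) / card (G \<inter> {0..<p})) - 1 / 4)"
  have quad: P if "p dvd u\<^sup>2 + c * u + d" "u \<in> ksum 3"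
      "\<And>a b :: int. a\<^sup>2 - c * a * b + d * b\<^sup>2 = 0 \<Longrightarrow> a = 0 \<and> b = 0" "\<bar>c\<bar> \<le> 1" "\<bar>d\<bar> \<le> 2" for u c d
    using ksum_UNIV_quadratic[OF that(2,1,4,5,3) p order(2)] unfolding P_def by metis
  have G_ksum: "\<omega> ^ i \<in> ksum 1" for i using power_mem[OF \<omega>(1)] unfolding ksum_1 by (simp add: G0_def)
  have pow_dvd: "p dvd \<omega> ^ i - 1 \<longleftrightarrow> \<tau> dvd i" for i using \<omega>(2)[of i] by (simp add: cong_iff_dvd_diff)
  have 3: P if "3 dvd \<tau>"
  proof -
    define w where "w = \<omega> ^ (\<tau> div 3)"
    have "p dvd w ^ 3 - 1" using pow_dvd[of \<tau>] that by (simp add: w_def power_mult[symmetric])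
    also have "w ^ 3 - 1 = (w - 1) * (w\<^sup>2 + 1 * w + 1)" by (simp add: algebra_simps power2_eq_square power3_eq_cube)
    finally have "p dvd (w - 1) * (w\<^sup>2 + 1 * w + 1)" .
    moreover have "\<not> p dvd w - 1" using pow_dvd[of "\<tau> div 3"] that order by (auto simp: w_def \<tau>_def dest: dvd_imp_le)
    ultimately have "p dvd w\<^sup>2 + 1 * w + 1" using prime_p prime_dvd_mult_iff by blast
    moreover have "w \<in> ksum 3" using G_ksum ksum_mono[of 1 3] by (auto simp: w_def)
    moreover have "a = 0 \<and> b = 0" if "a\<^sup>2 - 1 * a * b + 1 * b\<^sup>2 = 0" for a b :: int
      using that by (rule definite_form_nonzero) simp
    ultimately show P by (rule quad) simp_all
  qed
  have 4: P if "4 dvd \<tau>"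
  proof -
    define w where "w = \<omega> ^ (\<tau> div 4)"
    have "p dvd w ^ 4 - 1" using pow_dvd[of \<tau>] that by (simp add: w_def power_mult[symmetric])
    also have "w ^ 4 - 1 = (w\<^sup>2 - 1) * (w\<^sup>2 + 0 * w + 1)" by (simp add: algebra_simps power2_eq_square power4_eq_xxxx)
    finally have "p dvd (w\<^sup>2 - 1) * (w\<^sup>2 + 0 * w + 1)" .
    moreover have "\<not> p dvd w\<^sup>2 - 1"
      using pow_dvd[of "\<tau> div 4 * 2"] that order by (auto simp: w_def \<tau>_def power_mult[symmetric] dest: dvd_imp_le)
    ultimately have "p dvd w\<^sup>2 + 0 * w + 1" using prime_p prime_dvd_mult_iff by blast
    moreover have "w \<in> ksum 3" using G_ksum ksum_mono[of 1 3] by (auto simp: w_def)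
    moreover have "a = 0 \<and> b = 0" if "a\<^sup>2 - 0 * a * b + 1 * b\<^sup>2 = 0" for a b :: int
      using that by (rule definite_form_nonzero) simp
    ultimately show P by (rule quad) simp_all
  qed
  have 5: P if "5 dvd \<tau>"
  proof -
    define w where "w = \<omega> ^ (\<tau> div 5)"
    have w5: "p dvd w ^ 5 - 1" using pow_dvd[of \<tau>] that by (simp add: w_def power_mult[symmetric])
    also have "w ^ 5 - 1 = (w - 1) * (w ^ 4 + w ^ 3 + w\<^sup>2 + w + 1)" by (simp add: algebra_simps eval_nat_numeral)
    finally have "p dvd (w - 1) * (w ^ 4 + w ^ 3 + w\<^sup>2 + w + 1)" .
    moreover have "\<not> p dvd w - 1" using pow_dvd[of "\<tau> div 5"] that order by (auto simp: w_def \<tau>_def dest: dvd_imp_le)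
    ultimately have "p dvd w ^ 4 + w ^ 3 + w\<^sup>2 + w + 1" using prime_p prime_dvd_mult_iff by blast
    \<comment> \<open>A suitable multiple of \<open>w ^ 5 - 1\<close> turns the cyclotomic relation
      into the equation \<open>X\<^sup>2 + X - 1 = 0\<close> for the period
      \<open>w + w ^ 4\<close>.\<close>
    then have "p dvd (w ^ 4 + w ^ 3 + w\<^sup>2 + w + 1) + (w ^ 5 - 1) * (2 + w ^ 3)"
      using dvd_mult2[OF w5] by (rule dvd_add)
    also have "\<dots> = (w + w ^ 4)\<^sup>2 + 1 * (w + w ^ 4) + (-1)" by (simp add: algebra_simps eval_nat_numeral)
    finally have "p dvd (w + w ^ 4)\<^sup>2 + 1 * (w + w ^ 4) + (-1)" .
    moreover have "w + w ^ 4 \<in> ksum 3"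
      using ksum_add[OF G_ksum G_ksum, of "\<tau> div 5" "\<tau> div 5 * 4"] ksum_mono[of "1 + 1" 3]
      by (auto simp: w_def power_mult)
    moreover have "a = 0 \<and> b = 0" if "a\<^sup>2 - 1 * a * b + (- 1) * b\<^sup>2 = 0" for a b :: int
      using that by (intro golden_form_nonzero) simp
    ultimately show P by (rule quad) simp_all
  qed
  have 7: P if "7 dvd \<tau>"
  proof -
    define w where "w = \<omega> ^ (\<tau> div 7)"
    have w7: "p dvd w ^ 7 - 1" using pow_dvd[of \<tau>] that by (simp add: w_def power_mult[symmetric])
    also have "w ^ 7 - 1 = (w - 1) * (w ^ 6 + w ^ 5 + w ^ 4 + w ^ 3 + w\<^sup>2 + w + 1)"
      by (simp add: algebra_simps eval_nat_numeral)
    finally have "p dvd (w - 1) * (w ^ 6 + w ^ 5 + w ^ 4 + w ^ 3 + w\<^sup>2 + w + 1)" .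
    moreover have "\<not> p dvd w - 1" using pow_dvd[of "\<tau> div 7"] that order by (auto simp: w_def \<tau>_def dest: dvd_imp_le)
    ultimately have "p dvd w ^ 6 + w ^ 5 + w ^ 4 + w ^ 3 + w\<^sup>2 + w + 1" using prime_p prime_dvd_mult_iff by blast
    \<comment> \<open>Likewise the period \<open>w + w ^ 2 + w ^ 4\<close> satisfies
      \<open>X\<^sup>2 + X + 2 = 0\<close>.\<close>
    then have "p dvd (w ^ 6 + w ^ 5 + w ^ 4 + w ^ 3 + w\<^sup>2 + w + 1) * 2 + (w ^ 7 - 1) * w"
      using dvd_mult2[OF w7] by (rule dvd_add[OF dvd_mult2])
    also have "\<dots> = (w + w ^ 2 + w ^ 4)\<^sup>2 + 1 * (w + w ^ 2 + w ^ 4) + 2" by (simp add: algebra_simps eval_nat_numeral)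
    finally have "p dvd (w + w ^ 2 + w ^ 4)\<^sup>2 + 1 * (w + w ^ 2 + w ^ 4) + 2" .
    moreover have "w + w ^ 2 + w ^ 4 \<in> ksum 3"
      using ksum_add[OF ksum_add[OF G_ksum G_ksum] G_ksum, of "\<tau> div 7" "\<tau> div 7 * 2" "\<tau> div 7 * 4"]
      by (simp add: w_def power_mult numeral_3_eq_3)
    moreover have "a = 0 \<and> b = 0" if "a\<^sup>2 - 1 * a * b + 2 * b\<^sup>2 = 0" for a b :: int
      using that by (rule definite_form_nonzero) simp
    ultimately show P by (rule quad) simp_all
  qed
  have "even \<tau>" using even_card_G p by (simp add: \<tau>_def)
  then obtain h where "\<tau> = 2 * h" by (rule evenE)
  then have "h \<in> {2, 3, 4, 5, 6, 7}" using order by (auto simp: \<tau>_def)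
  then have "3 dvd \<tau> \<or> 4 dvd \<tau> \<or> 5 dvd \<tau> \<or> 7 dvd \<tau>" using \<open>\<tau> = 2 * h\<close> by auto
  then show ?thesis using 3 4 5 7 that unfolding P_def by blast
qed

text \<open>Large order is handled by growth and small index by packing. In the remaining case the
  order is even, hence at least 4, and an index above 99 gives \<open>p - 1 > 396\<close>, which is
  the size required for the quadratic boxes.\<close>

theorem ksum_UNIV_sqrt:
  assumes "card (G \<inter> {0..<p}) \<ge> 3"
  obtains L where "ksum L = UNIV"
    "real L \<le> 30 * sqrt (real_of_int (p - 1) / card (G \<inter> {0..<p})) - 1 / 4"
proof -
  consider "card (G \<inter> {0..<p}) \<ge> 15" | "real_of_int (p - 1) / card (G \<inter> {0..<p}) \<le> 99"
    | "card (G \<inter> {0..<p}) \<le> 14" "real_of_int (p - 1) / card (G \<inter> {0..<p}) > 99" by linarith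
  then show ?thesis
  proof cases
    case 3
    have pos: "real (card (G \<inter> {0..<p})) \<ge> 4"
    proof -
      have "p \<noteq> 2" using card_G_le assms by auto
      then have "even (card (G \<inter> {0..<p}))" by (rule even_card_G)
      moreover have "card (G \<inter> {0..<p}) \<noteq> 3" using calculation by presburger
      ultimately show ?thesis using assms by linarith
    qed
    then have "99 * real (card (G \<inter> {0..<p})) < real_of_int (p - 1)" using 3(2) by (simp add: field_simps)
    then have "p \<ge> 398" using pos by linarith
    then show ?thesis using ksum_UNIV_small_order assms 3(1) that by blast
  qed (use ksum_UNIV_large_order ksum_UNIV_small_index that in blast)+
qed

end

section \<open>Convolution with a subgroup\<close>

lemma sum_residues_affine:
  fixes f :: "int \<Rightarrow> real" and p c :: int
  assumes "p > 0" "coprime c p" and per: "\<And>x. f (x mod p) = f x"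
  shows "(\<Sum>x\<in>{0..<p}. f (c * x + e)) = (\<Sum>x\<in>{0..<p}. f x)"
proof -
  have "(\<Sum>x\<in>{0..<p}. f (c * x + e)) = (\<Sum>x\<in>{0..<p}. f ((c * x + e) mod p))" by (simp add: per)
  also have "\<dots> = (\<Sum>x\<in>{0..<p}. f x)"
    by (rule sum.reindex_bij_betw) (rule bij_betw_residues_affine[OF assms(2,1)])
  finally show ?thesis .
qed

lemma sum_residues_shift:
  fixes f :: "int \<Rightarrow> real" and p :: int
  assumes "p > 0" "\<And>x. f (x mod p) = f x"
  shows "(\<Sum>x\<in>{0..<p}. f (x + e)) = (\<Sum>x\<in>{0..<p}. f x)"
  using sum_residues_affine[of p 1 f e] assms by simp

lemma sum_residues_reflect:
  fixes f :: "int \<Rightarrow> real" and p :: int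
  assumes "p > 0" "\<And>x. f (x mod p) = f x"
  shows "(\<Sum>x\<in>{0..<p}. f (- x - e)) = (\<Sum>x\<in>{0..<p}. f x)"
  using sum_residues_affine[of p "- 1" f "- e"] assms by simp

lemma uminus_mod_diff:
  fixes x z p :: int
  shows "(- (x mod p) - z) mod p = (- x - z) mod p"
  by (metis mod_diff_left_eq mod_minus_eq)

context residue_subgroup
begin

text \<open>Functions on residues are modelled as \<open>p\<close>-periodic functions on the
  integers.\<close>

definition periodic :: "(int \<Rightarrow> real) \<Rightarrow> bool" where
  "periodic f \<longleftrightarrow> (\<forall>x. f (x mod p) = f x)"

lemma periodicD: "periodic f \<Longrightarrow> f (x mod p) = f x"
  by (simp add: periodic_def)

lemma periodic_eqI: "periodic f \<Longrightarrow> x mod p = y mod p \<Longrightarrow> f x = f y"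
  by (metis periodicD)

text \<open>Adjacency operator of the sum graph joining \<open>v\<close> and \<open>w\<close> when
  \<open>v + w\<close> lies in \<open>-G\<close>. The reflection makes it self-adjoint even if
  \<open>G\<close> is not symmetric.\<close>

definition adj :: "(int \<Rightarrow> real) \<Rightarrow> int \<Rightarrow> real" where
  "adj f v = (\<Sum>z\<in>G \<inter> {0..<p}. f (- v - z))"

lemma periodic_adj: "periodic f \<Longrightarrow> periodic (adj f)"
  unfolding periodic_def adj_def
  by (intro allI sum.cong refl periodic_eqI) (auto simp: periodic_def uminus_mod_diff)

lemma adj_add_const:
  fixes c :: real
  shows "adj (\<lambda>x. f x + c) = (\<lambda>v. adj f v + card (G \<inter> {0..<p}) * c)"
  by (auto simp: adj_def sum.distrib fun_eq_iff)

lemma sum_adj: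
  fixes f :: "int \<Rightarrow> real"
  assumes "periodic f"
  shows "(\<Sum>v\<in>{0..<p}. adj f v) = card (G \<inter> {0..<p}) * (\<Sum>v\<in>{0..<p}. f v)"
proof -
  have "(\<Sum>v\<in>{0..<p}. adj f v) = (\<Sum>z\<in>G \<inter> {0..<p}. \<Sum>v\<in>{0..<p}. f (- v - z))"
    unfolding adj_def by (rule sum.swap)
  also have "\<dots> = (\<Sum>z\<in>G \<inter> {0..<p}. \<Sum>v\<in>{0..<p}. f v)"
    using assms p_pos by (intro sum.cong refl sum_residues_reflect) (auto simp: periodic_def)
  finally show ?thesis by simp
qed

text \<open>For each \<open>z\<close> the substitution \<open>v \<mapsto> - v - z\<close> is an
  involution of the residues and moves the operator from one factor to the other.\<close>

lemma adj_selfadjoint: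
  fixes f g :: "int \<Rightarrow> real"
  assumes "periodic f" "periodic g"
  shows "(\<Sum>v\<in>{0..<p}. adj f v * g v) = (\<Sum>v\<in>{0..<p}. f v * adj g v)"
proof -
  have "(\<Sum>v\<in>{0..<p}. adj f v * g v) = (\<Sum>z\<in>G \<inter> {0..<p}. \<Sum>v\<in>{0..<p}. f (- v - z) * g v)"
    unfolding adj_def sum_distrib_right by (rule sum.swap)
  also have "\<dots> = (\<Sum>z\<in>G \<inter> {0..<p}. \<Sum>v\<in>{0..<p}. f v * g (- v - z))"
  proof (rule sum.cong[OF refl])
    fix z
    define h where "h v = f v * g (- v - z)" for v
    have "f (x mod p) = f x" "g (- (x mod p) - z) = g (- x - z)" for x
      using assms by (auto intro!: periodic_eqI simp: uminus_mod_diff)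
    then have "h (x mod p) = h x" for x by (simp add: h_def)
    then have "(\<Sum>v\<in>{0..<p}. h (- v - z)) = (\<Sum>v\<in>{0..<p}. h v)"
      using p_pos by (intro sum_residues_reflect)
    then show "(\<Sum>v\<in>{0..<p}. f (- v - z) * g v) = (\<Sum>v\<in>{0..<p}. f v * g (- v - z))"
      by (simp add: h_def)
  qed
  also have "\<dots> = (\<Sum>v\<in>{0..<p}. f v * adj g v)"
    unfolding adj_def sum_distrib_left by (rule sum.swap)
  finally show ?thesis .
qed

lemma sum_mult_permutes_G:
  fixes f :: "int \<Rightarrow> real"
  assumes "periodic f" "\<xi> \<in> G"
  shows "(\<Sum>z\<in>G \<inter> {0..<p}. f (w - \<xi> * z)) = (\<Sum>z\<in>G \<inter> {0..<p}. f (w - z))"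
proof -
  define h where "h = (\<lambda>z. (\<xi> * z + 0) mod p)"
  have "inj_on h {0..<p}" unfolding h_def
    using assms(2) not_dvd prime_p by (intro inj_on_residues_affine coprime_prime_residue) auto
  then have inj: "inj_on h (G \<inter> {0..<p})" by (rule inj_on_subset) simp
  have "h ` (G \<inter> {0..<p}) \<subseteq> G \<inter> {0..<p}"
    using assms(2) mult_mem p_pos by (auto simp: h_def mod_mem_iff)
  then have "h ` (G \<inter> {0..<p}) = G \<inter> {0..<p}" using inj by (intro endo_inj_surj) auto
  then have bij: "bij_betw h (G \<inter> {0..<p}) (G \<inter> {0..<p})" using inj by (simp add: bij_betw_def)
  have "(\<Sum>z\<in>G \<inter> {0..<p}. f (w - \<xi> * z)) = (\<Sum>z\<in>G \<inter> {0..<p}. f (w - h z))"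
    by (intro sum.cong refl periodic_eqI[OF assms(1)]) (simp add: h_def mod_simps)
  also have "\<dots> = (\<Sum>z\<in>G \<inter> {0..<p}. f (w - z))" by (rule sum.reindex_bij_betw[OF bij])
  finally show ?thesis .
qed

text \<open>The quadratic form below is nonnegative for every dilation factor \<open>\<xi>\<close>, takes the same value
  for all \<open>\<xi>\<close> in the subgroup, and is easily summed over all \<open>\<xi>\<close>.\<close>

lemma adj_norm:
  fixes f :: "int \<Rightarrow> real"
  assumes f: "periodic f" and mean: "(\<Sum>v\<in>{0..<p}. f v) = 0"
  shows "(\<Sum>v\<in>{0..<p}. (adj f v)\<^sup>2) \<le> real_of_int p * (\<Sum>v\<in>{0..<p}. (f v)\<^sup>2)"
proof -
  define H where "H = G \<inter> {0..<p}"
  define t where "t = card H"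
  have finH: "finite H" by (simp add: H_def)
  have t0: "t > 0" using card_G_pos by (simp only: t_def H_def)
  define Q where "Q \<xi> = (\<Sum>w\<in>{0..<p}. (\<Sum>z\<in>H. f (w - \<xi> * z))\<^sup>2)" for \<xi>
  define C where "C s = (\<Sum>w\<in>{0..<p}. f w * f (w + s))" for s
  have Q0: "Q \<xi> \<ge> 0" for \<xi> by (auto simp: Q_def intro: sum_nonneg)
  have Q1: "Q \<xi> = Q 1" if "\<xi> \<in> G" for \<xi>
    using sum_mult_permutes_G[OF f that] by (simp add: Q_def H_def)
  have adjQ: "(\<Sum>v\<in>{0..<p}. (adj f v)\<^sup>2) = Q 1"
  proof -
    define h where "h v = (\<Sum>z\<in>H. f (v - z))\<^sup>2" for v
    have "f (x mod p - z) = f (x - z)" for x z using f by (auto intro!: periodic_eqI simp: mod_simps)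
    then have "h (x mod p) = h x" for x by (simp add: h_def)
    then have "(\<Sum>v\<in>{0..<p}. h (- v - 0)) = (\<Sum>v\<in>{0..<p}. h v)"
      using p_pos by (intro sum_residues_reflect)
    then show ?thesis by (simp add: h_def Q_def adj_def H_def)
  qed
  have Cper: "C (s mod p) = C s" for s
    unfolding C_def using f by (intro sum.cong refl arg_cong2[of _ _ _ _ "(*)"] periodic_eqI) (auto simp: mod_simps)
  have corr: "(\<Sum>w\<in>{0..<p}. f (w - a) * f (w - b)) = C (a - b)" for a b
  proof -
    define h where "h v = f (v - a) * f (v - b)" for v
    have "f (x mod p - z) = f (x - z)" for x z using f by (auto intro!: periodic_eqI simp: mod_simps)
    then have "h (x mod p) = h x" for x by (simp add: h_def)
    then have "(\<Sum>v\<in>{0..<p}. h (v + a)) = (\<Sum>v\<in>{0..<p}. h v)"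
      using p_pos by (intro sum_residues_shift)
    then show ?thesis by (simp add: h_def C_def algebra_simps)
  qed
  have QC: "Q \<xi> = (\<Sum>z\<in>H. \<Sum>z'\<in>H. C (\<xi> * (z - z')))" for \<xi>
  proof -
    have "Q \<xi> = (\<Sum>w\<in>{0..<p}. \<Sum>z\<in>H. \<Sum>z'\<in>H. f (w - \<xi> * z) * f (w - \<xi> * z'))"
      by (simp add: Q_def power2_eq_square sum_product)
    also have "\<dots> = (\<Sum>z\<in>H. \<Sum>w\<in>{0..<p}. \<Sum>z'\<in>H. f (w - \<xi> * z) * f (w - \<xi> * z'))"
      by (rule sum.swap)
    also have "\<dots> = (\<Sum>z\<in>H. \<Sum>z'\<in>H. \<Sum>w\<in>{0..<p}. f (w - \<xi> * z) * f (w - \<xi> * z'))"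
      by (intro sum.cong refl sum.swap)
    finally show ?thesis by (simp add: corr right_diff_distrib)
  qed
  have Csum: "(\<Sum>s\<in>{0..<p}. C s) = 0"
  proof -
    have zero: "(\<Sum>s\<in>{0..<p}. f (s + w)) = 0" for w
      using sum_residues_shift[OF p_pos, of f w] f mean by (simp add: periodic_def)
    have "(\<Sum>s\<in>{0..<p}. C s) = (\<Sum>w\<in>{0..<p}. f w * (\<Sum>s\<in>{0..<p}. f (s + w)))"
      unfolding C_def sum_distrib_left by (subst sum.swap) (simp add: add.commute)
    then show ?thesis by (simp add: zero)
  qed
  have C0: "C 0 = (\<Sum>v\<in>{0..<p}. (f v)\<^sup>2)" by (simp add: C_def power2_eq_square)
  then have C0_nonneg: "C 0 \<ge> 0" by (simp add: sum_nonneg)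
  have split0: "{0..<p} = insert 0 {1..<p}" using p_pos by auto
  \<comment> \<open>For distinct \<open>z\<close> and \<open>z'\<close> the products
    \<open>\<xi> * (z - z')\<close> run over all nonzero residues. As \<open>C\<close> sums to 0
    over all residues, these terms sum to \<open>- C 0\<close>, which is at most 0.\<close>
  have off: "(\<Sum>\<xi>\<in>{1..<p}. C (\<xi> * (z - z'))) \<le> (if z = z' then real_of_int p * C 0 else 0)"
    if "z \<in> H" "z' \<in> H" for z z'
  proof (cases "z = z'")
    case True
    have "(\<Sum>\<xi>\<in>{1..<p}. C (\<xi> * (z - z'))) = real_of_int (p - 1) * C 0" using True p_pos by simp
    also have "\<dots> \<le> real_of_int p * C 0" using C0_nonneg by (intro mult_right_mono) auto
    finally show ?thesis using True by simp
  next
    case False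
    have "\<not> p dvd z - z'"
    proof
      assume "p dvd z - z'"
      then have "z mod p = z' mod p" by (simp add: mod_eq_dvd_iff)
      then show False using that False by (simp add: H_def)
    qed
    then have "coprime (z - z') p" using prime_p by (rule coprime_prime_residue[rotated])
    then have "(\<Sum>\<xi>\<in>{0..<p}. C ((z - z') * \<xi> + 0)) = 0"
      using sum_residues_affine[of p "z - z'" C 0] Cper Csum p_pos by simp
    then have "C 0 + (\<Sum>\<xi>\<in>{1..<p}. C (\<xi> * (z - z'))) = 0"
      unfolding split0 by (simp add: mult.commute)
    then show ?thesis using False C0_nonneg by simp
  qed
  \<comment> \<open>The \<open>t\<close> equal values on \<open>H\<close> are part of a sum of
    nonnegative values over all nonzero factors.\<close>
  have "real t * Q 1 = (\<Sum>\<xi>\<in>H. Q \<xi>)" using Q1 by (simp add: t_def H_def)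
  also have "\<dots> \<le> (\<Sum>\<xi>\<in>{1..<p}. Q \<xi>)"
  proof (rule sum_mono2)
    have "0 \<notin> G" using not_dvd by fastforce
    then show "H \<subseteq> {1..<p}" by (auto simp: H_def order_le_less)
  qed (use Q0 in auto)
  also have "\<dots> = (\<Sum>z\<in>H. \<Sum>z'\<in>H. \<Sum>\<xi>\<in>{1..<p}. C (\<xi> * (z - z')))"
    unfolding QC by (subst sum.swap, intro sum.cong refl sum.swap)
  also have "\<dots> \<le> (\<Sum>z\<in>H. \<Sum>z'\<in>H. if z = z' then real_of_int p * C 0 else 0)"
    by (intro sum_mono off)
  also have "\<dots> = real t * (real_of_int p * C 0)" using finH by (simp add: t_def)
  finally have "Q 1 \<le> real_of_int p * C 0" using t0 by simp
  then show ?thesis using adjQ C0 by simp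
qed

text \<open>Each unit of \<open>k\<close> stands for one three-step walk
  \<open>v \<mapsto> - v - z\<close>. This map is its own inverse, so the last move is undone by the
  same formula.\<close>

primrec alt_reach :: "nat \<Rightarrow> int \<Rightarrow> int \<Rightarrow> bool" where
  "alt_reach 0 u v \<longleftrightarrow> [u = v] (mod p)"
| "alt_reach (Suc k) u v \<longleftrightarrow> (\<exists>z\<in>G. alt_reach k u (- v - z))"

text \<open>The number of ways to reach \<open>v\<close> from \<open>u\<close> is the inner product
  of \<open>adj\<^sup>3 (\<delta> u)\<close> and \<open>adj\<^sup>2 (\<delta> v)\<close>. Its main
  term is \<open>t ^ 5 / P\<close>, and the mean-zero parts contribute at most
  \<open>sqrt (P\<^sup>2 * t) * sqrt (P * t)\<close>, which is smaller exactly when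
  \<open>P ^ 5 < t ^ 8\<close>.\<close>

theorem alt_reach_5:
  assumes large: "p ^ 5 < int (card (G \<inter> {0..<p})) ^ 8"
  shows "alt_reach 5 u v"
proof (rule ccontr)
  assume not: "\<not> alt_reach 5 u v"
  define t where "t = real (card (G \<inter> {0..<p}))"
  define P where "P = real_of_int p"
  have t0: "t > 0" using card_G_pos unfolding t_def by (simp only: of_nat_0_less_iff)
  have P0: "P > 0" using p_pos by (simp add: P_def)
  define \<delta> where "\<delta> u x = (if [u = x] (mod p) then 1 else (0::real))" for u x :: int
  define f where "f u x = \<delta> u x - 1 / P" for u x
  have per\<delta>: "periodic (\<delta> u)" for u by (simp add: periodic_def \<delta>_def cong_def)
  then have perf: "periodic (f u)" for u by (simp add: periodic_def f_def)
  have sum\<delta>: "(\<Sum>x\<in>{0..<p}. g x * \<delta> u x) = g (u mod p)" for u and g :: "int \<Rightarrow> real"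
  proof -
    have "\<delta> u x = (if x = u mod p then 1 else 0)" if "x \<in> {0..<p}" for x
      using that by (auto simp: \<delta>_def cong_def)
    then have "(\<Sum>x\<in>{0..<p}. g x * \<delta> u x) = (\<Sum>x\<in>{0..<p}. if x = u mod p then g x else 0)"
      by (intro sum.cong) auto
    then show ?thesis using p_pos by simp
  qed
  have sumf: "(\<Sum>x\<in>{0..<p}. f u x) = 0" for u
    using sum\<delta>[of "\<lambda>_. 1" u] P0 p_pos by (simp add: f_def sum_subtractf P_def)
  have \<delta>f: "\<delta> u = (\<lambda>x. f u x + 1 / P)" for u by (simp add: f_def)
  have adj1: "adj (\<delta> u) = (\<lambda>x. adj (f u) x + t / P)" for u
    using adj_add_const[of "f u" "1 / P"] by (simp add: t_def \<delta>f[symmetric])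
  have adj2: "adj (adj (\<delta> u)) = (\<lambda>x. adj (adj (f u)) x + t\<^sup>2 / P)" for u
    using adj_add_const[of "adj (f u)" "t / P"] by (simp add: t_def adj1 power2_eq_square)
  have adj3: "adj (adj (adj (\<delta> u))) = (\<lambda>x. adj (adj (adj (f u))) x + t ^ 3 / P)" for u
    using adj_add_const[of "adj (adj (f u))" "t\<^sup>2 / P"] by (simp add: t_def adj2 power2_eq_square power3_eq_cube mult.assoc)
  \<comment> \<open>The first application is computed directly, since
    \<open>adj (\<delta> u)\<close> is the indicator of a set of size \<open>t\<close>; the general
    norm bound would only give about \<open>P\<close> here.\<close>
  have norm1: "(\<Sum>x\<in>{0..<p}. (adj (f u) x)\<^sup>2) \<le> t" for u
  proof -
    have 01: "adj (\<delta> u) x \<in> {0, 1}" for x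
    proof -
      have "card {z \<in> G \<inter> {0..<p}. [u = - x - z] (mod p)} \<le> card {(- x - u) mod p}"
      proof (rule card_mono)
        show "{z \<in> G \<inter> {0..<p}. [u = - x - z] (mod p)} \<subseteq> {(- x - u) mod p}"
        proof clarify
          fix z assume z: "z \<in> {0..<p}" and "[u = - x - z] (mod p)"
          then have "[z = - x - u] (mod p)" by (simp add: cong_iff_dvd_diff algebra_simps)
          then show "z = (- x - u) mod p" using z by (simp add: cong_def)
        qed
      qed simp
      then have "card {z \<in> G \<inter> {0..<p}. [u = - x - z] (mod p)} \<le> 1" by simp
      moreover have "adj (\<delta> u) x = card {z \<in> G \<inter> {0..<p}. [u = - x - z] (mod p)}"
        by (simp add: adj_def \<delta>_def sum.inter_filter[symmetric])
      ultimately show ?thesis by auto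
    qed
    have "(\<Sum>x\<in>{0..<p}. (adj (f u) x)\<^sup>2) = (\<Sum>x\<in>{0..<p}. (adj (\<delta> u) x - t / P)\<^sup>2)"
      by (simp add: adj1)
    also have "\<dots> = (\<Sum>x\<in>{0..<p}. (1 - 2 * (t / P)) * adj (\<delta> u) x + (t / P)\<^sup>2)"
      using 01 by (intro sum.cong refl) (fastforce simp: power2_eq_square algebra_simps)
    also have "\<dots> = (1 - 2 * (t / P)) * t + P * (t / P)\<^sup>2"
      using sum_adj[OF per\<delta>, of u] sum\<delta>[of "\<lambda>_. 1" u] p_pos
      by (simp add: sum.distrib sum_distrib_left[symmetric] t_def P_def)
    also have "\<dots> = t - t\<^sup>2 / P" using P0 by (simp add: field_simps power2_eq_square)
    also have "\<dots> \<le> t" using P0 by simp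
    finally show ?thesis .
  qed
  have norm2: "(\<Sum>x\<in>{0..<p}. (adj (adj (f u)) x)\<^sup>2) \<le> P * t" for u
  proof -
    have "(\<Sum>x\<in>{0..<p}. (adj (adj (f u)) x)\<^sup>2) \<le> P * (\<Sum>x\<in>{0..<p}. (adj (f u) x)\<^sup>2)"
      using adj_norm[OF periodic_adj[OF perf]] sum_adj[OF perf] sumf by (simp add: P_def)
    also have "\<dots> \<le> P * t" using norm1 P0 by (intro mult_left_mono) auto
    finally show ?thesis .
  qed
  have norm3: "(\<Sum>x\<in>{0..<p}. (adj (adj (adj (f u))) x)\<^sup>2) \<le> P\<^sup>2 * t" for u
  proof -
    have "(\<Sum>x\<in>{0..<p}. (adj (adj (adj (f u))) x)\<^sup>2) \<le> P * (\<Sum>x\<in>{0..<p}. (adj (adj (f u)) x)\<^sup>2)"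
      using adj_norm[OF periodic_adj[OF periodic_adj[OF perf]]] sum_adj[OF perf] sum_adj[OF periodic_adj[OF perf]] sumf
      by (simp add: P_def)
    also have "\<dots> \<le> P * (P * t)" using norm2 P0 by (intro mult_left_mono) auto
    finally show ?thesis by (simp add: power2_eq_square ac_simps)
  qed
  \<comment> \<open>The iterate counts the alternating sequences from \<open>u\<close> to
    \<open>x\<close>, of which there are none.\<close>
  have iter: "(adj ^^ k) (\<delta> u) x = 0" if "\<not> alt_reach k u x" for k x
    using that
  proof (induction k arbitrary: x)
    case (Suc k)
    then have "\<forall>z\<in>G \<inter> {0..<p}. (adj ^^ k) (\<delta> u) (- x - z) = 0" by auto
    then show ?case by (simp add: adj_def[of "(adj ^^ k) (\<delta> u)"])
  qed (simp add: \<delta>_def)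
  define F3 where "F3 = adj (adj (adj (f u)))"
  define F2 where "F2 = adj (adj (f v))"
  have sumF: "(\<Sum>x\<in>{0..<p}. F3 x) = 0" "(\<Sum>x\<in>{0..<p}. F2 x) = 0"
    using sum_adj perf sumf periodic_adj by (simp_all add: F3_def F2_def)
  have "0 = adj (adj (adj (adj (adj (\<delta> u))))) (v mod p)"
  proof -
    have "(adj ^^ 5) (\<delta> u) v = 0" using not by (rule iter)
    then have "adj (adj (adj (adj (adj (\<delta> u))))) v = 0" by (simp add: eval_nat_numeral)
    moreover have "periodic (adj (adj (adj (adj (adj (\<delta> u))))))" by (intro periodic_adj per\<delta>)
    ultimately show ?thesis by (simp only: periodicD)
  qed
  also have "\<dots> = (\<Sum>x\<in>{0..<p}. adj (adj (adj (adj (adj (\<delta> u))))) x * \<delta> v x)"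
    by (simp add: sum\<delta>)
  \<comment> \<open>Self-adjointness moves two of the five applications onto
    \<open>\<delta> v\<close>.\<close>
  also have "\<dots> = (\<Sum>x\<in>{0..<p}. adj (adj (adj (\<delta> u))) x * adj (adj (\<delta> v)) x)"
    using adj_selfadjoint periodic_adj per\<delta> by simp
  also have "\<dots> = (\<Sum>x\<in>{0..<p}. (F3 x + t ^ 3 / P) * (F2 x + t\<^sup>2 / P))"
    by (simp only: adj3 F3_def F2_def) (simp only: adj2)
  also have "\<dots> = (\<Sum>x\<in>{0..<p}. F3 x * F2 x + t\<^sup>2 / P * F3 x + t ^ 3 / P * F2 x + t ^ 5 / P\<^sup>2)"
    by (intro sum.cong refl) (simp add: algebra_simps power2_eq_square eval_nat_numeral)
  also have "\<dots> = (\<Sum>x\<in>{0..<p}. F3 x * F2 x) + t\<^sup>2 / P * (\<Sum>x\<in>{0..<p}. F3 x)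
      + t ^ 3 / P * (\<Sum>x\<in>{0..<p}. F2 x) + P * (t ^ 5 / P\<^sup>2)"
    unfolding sum.distrib sum_distrib_left[symmetric] using p_pos by (simp add: P_def)
  also have "\<dots> = (\<Sum>x\<in>{0..<p}. F3 x * F2 x) + t ^ 5 / P"
    using P0 by (simp add: sumF power2_eq_square)
  finally have "(t ^ 5 / P)\<^sup>2 = (\<Sum>x\<in>{0..<p}. F3 x * F2 x)\<^sup>2" by (simp add: power2_eq_iff)
  also have "\<dots> \<le> (\<Sum>x\<in>{0..<p}. (F3 x)\<^sup>2) * (\<Sum>x\<in>{0..<p}. (F2 x)\<^sup>2)"
    by (rule Cauchy_Schwarz_ineq_sum)
  also have "\<dots> \<le> (P\<^sup>2 * t) * (P * t)"
    unfolding F3_def F2_def using norm3 norm2 P0 t0 by (intro mult_mono) (auto intro: sum_nonneg)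
  finally have "t ^ 8 * t\<^sup>2 \<le> P ^ 5 * t\<^sup>2" using P0 by (simp add: field_simps eval_nat_numeral)
  then have "t ^ 8 \<le> P ^ 5" by (rule mult_right_le_imp_le) (use t0 in simp)
  moreover have "real_of_int (p ^ 5) < real_of_int (int (card (G \<inter> {0..<p})) ^ 8)"
    using large by (simp only: of_int_less_iff)
  then have "P ^ 5 < t ^ 8" by (simp add: P_def t_def)
  ultimately show False by simp
qed

end

section \<open>Walks in monomial digraphs\<close>

locale monomial_params =
  fixes p m n :: nat
  assumes prime_p: "prime p" and m_pos: "1 \<le> m" and n_pos: "1 \<le> n"
begin

sublocale digraph: wf_digraph "with_proj (monomial_digraph p m n)"
  unfolding wf_digraph_wp_iff by (rule wf_monomial_digraph)

text \<open>Vertices are addressed by arbitrary integer representatives of their coordinates.\<close>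

definition W :: "nat \<Rightarrow> int \<Rightarrow> int \<Rightarrow> int \<Rightarrow> int \<Rightarrow> bool" where
  "W l x u y v \<longleftrightarrow> (\<exists>w. digraph.awalk (x mod int p, u mod int p) w (y mod int p, v mod int p) \<and> length w = l)"

lemma p_gt_1: "p > 1" using prime_p by (rule prime_gt_1_nat)

lemma prime_int_p: "prime (int p)" using prime_p by simp

lemma mod_in_verts: "(x mod int p, u mod int p) \<in> verts (with_proj (monomial_digraph p m n))"
  using p_gt_1 by (simp add: verts_monomial_digraph)

lemma W_0: "[x = y] (mod int p) \<Longrightarrow> [u = v] (mod int p) \<Longrightarrow> W 0 x u y v"
  using mod_in_verts by (auto simp: W_def cong_def digraph.awalk_Nil_iff)

lemma W_cong:
  "[x = x'] (mod int p) \<Longrightarrow> [u = u'] (mod int p) \<Longrightarrow> [y = y'] (mod int p) \<Longrightarrow> [v = v'] (mod int p) \<Longrightarrow>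
    W l x u y v \<longleftrightarrow> W l x' u' y' v'"
  by (simp add: W_def cong_def)

lemma W_cong_end: "W l x u y v \<Longrightarrow> [v = v'] (mod int p) \<Longrightarrow> W l x u y v'"
  by (simp add: W_def cong_def)

lemma W_trans: "W k x u y v \<Longrightarrow> W l y v z w \<Longrightarrow> W (k + l) x u z w"
  unfolding W_def using digraph.awalk_appendI by (metis length_append)

lemma W_step:
  assumes "[u + v = x ^ m * y ^ n] (mod int p)"
  shows "W 1 x u y v"
proof -
  have "[u mod int p + v mod int p = (x mod int p) ^ m * (y mod int p) ^ n] (mod int p)"
  proof -
    have "[u mod int p + v mod int p = u + v] (mod int p)"
      by (intro cong_add) (auto simp: cong_def)
    also note assms
    also have "[x ^ m * y ^ n = (x mod int p) ^ m * (y mod int p) ^ n] (mod int p)"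
      by (intro cong_mult cong_pow) (auto simp: cong_def)
    finally show ?thesis .
  qed
  then have "((x mod int p, u mod int p), (y mod int p, v mod int p)) \<in> arcs (with_proj (monomial_digraph p m n))"
    using arc_monomial_digraph_iff[OF p_gt_1] mod_in_verts by simp
  from digraph.arc_implies_awalk[OF this] show ?thesis unfolding W_def
    by (intro exI[of _ "[((x mod int p, u mod int p), (y mod int p, v mod int p))]"]) simp
qed

lemma W_to_zero: "W 1 x u 0 (- u)"
  using n_pos by (intro W_step) (simp add: power_0_left)

lemma W_from_zero: "W 1 0 u y (- u)"
  using m_pos by (intro W_step) (simp add: power_0_left)

lemma W_via_zero:
  assumes "W l 0 (- u) 0 (- v)"
  shows "W (l + 2) x u y v"
  using W_trans[OF W_trans[OF W_to_zero[of x u] assms] W_from_zero[of "- v" y]] by simp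

definition H :: "int set" where
  "H = {z. \<exists>x y. \<not> int p dvd x \<and> \<not> int p dvd y \<and> [z = x ^ m * y ^ n] (mod int p)}"

lemma H_subgroup: "residue_subgroup (int p) H"
proof
  show "prime (int p)" by (rule prime_int_p)
  show "1 \<in> H" using p_gt_1 unfolding H_def by (auto intro!: exI[of _ 1])
  show "x * y \<in> H" if xy: "x \<in> H" "y \<in> H" for x y
  proof -
    obtain a b c d where *: "\<not> int p dvd a" "\<not> int p dvd b" "[x = a ^ m * b ^ n] (mod int p)"
      "\<not> int p dvd c" "\<not> int p dvd d" "[y = c ^ m * d ^ n] (mod int p)"
      using xy by (auto simp: H_def)
    have "[x * y = (a ^ m * b ^ n) * (c ^ m * d ^ n)] (mod int p)" using *(3,6) by (rule cong_mult)
    also have "(a ^ m * b ^ n) * (c ^ m * d ^ n) = (a * c) ^ m * (b * d) ^ n" by (simp add: power_mult_distrib ac_simps)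
    finally show ?thesis using * prime_int_p unfolding H_def
      by (intro CollectI exI[of _ "a * c"] exI[of _ "b * d"]) (auto simp: prime_dvd_mult_iff)
  qed
  show "y \<in> H" if "x \<in> H" "[x = y] (mod int p)" for x y
    using that unfolding H_def by (blast intro: cong_trans cong_sym)
  show "\<not> int p dvd x" if "x \<in> H" for x
  proof
    assume "int p dvd x"
    moreover obtain a b where *: "\<not> int p dvd a" "\<not> int p dvd b" "[x = a ^ m * b ^ n] (mod int p)"
      using \<open>x \<in> H\<close> by (auto simp: H_def)
    ultimately have "int p dvd a ^ m * b ^ n" by (simp add: cong_dvd_iff)
    then show False using *(1,2) prime_dvd_power[OF prime_int_p] prime_dvd_mult_iff[OF prime_int_p] by blast
  qed
qed

sublocale H: residue_subgroup "int p" H by (rule H_subgroup)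

abbreviation t :: nat where "t \<equiv> card (H \<inter> {0..<int p})"

lemma power_mem_H:
  assumes "\<not> int p dvd g"
  shows "g ^ m \<in> H" "g ^ n \<in> H"
proof -
  have 1: "\<not> int p dvd 1" using p_gt_1 by simp
  show "g ^ m \<in> H" unfolding H_def using assms 1 by (intro CollectI exI[of _ g] exI[of _ 1]) simp
  show "g ^ n \<in> H" unfolding H_def using assms 1 by (intro CollectI exI[of _ 1] exI[of _ g]) simp
qed

text \<open>\<open>H\<close> contains the \<open>m\<close>-th and \<open>n\<close>-th powers of a
  primitive root, and the exponent \<open>t\<close> kills them.\<close>

lemma card_H_dvd: "p - 1 dvd m * t" "p - 1 dvd n * t"
proof -
  obtain g :: int where g: "\<not> int p dvd g" "\<And>i. [g ^ i = 1] (mod int p) \<longleftrightarrow> nat (int p - 1) dvd i"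
    "\<And>x. \<not> int p dvd x \<Longrightarrow> \<exists>i. [x = g ^ i] (mod int p)"
    using int_primitive_root[OF prime_int_p] by blast
  have "[g ^ (m * t) = 1] (mod int p)" "[g ^ (n * t) = 1] (mod int p)"
    using power_mem_H[OF g(1), THEN H.power_card_cong_1] by (simp_all add: power_mult)
  moreover have "nat (int p - 1) = p - 1" by simp
  ultimately show "p - 1 dvd m * t" "p - 1 dvd n * t" by (simp_all add: g(2))
qed

lemma t_pos: "t > 0" by (rule H.card_G_pos)

lemma index_le_m: "p - 1 \<le> m * t"
proof (rule dvd_imp_le[OF card_H_dvd(1)])
  have "0 < m" using m_pos by simp
  then show "0 < m * t" using t_pos by (rule mult_pos_pos)
qed

lemma W_3:
  assumes "z \<in> H.G0"
  shows "W 3 0 u 0 (- u - z)"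
proof (cases "int p dvd z")
  case True
  have "W (1 + 1 + 1) 0 u 0 (- u)"
    using W_trans[OF W_trans[OF W_to_zero[of 0 u] W_to_zero] W_to_zero] by simp
  moreover have "[- u = - u - z] (mod int p)" using True by (simp add: cong_iff_dvd_diff)
  ultimately show ?thesis using W_cong_end[of 3 0 u 0 "- u"] by (simp add: numeral_3_eq_3)
next
  case False
  then have "z \<in> H" using assms by (simp add: H.G0_def)
  then obtain x y where "[z = x ^ m * y ^ n] (mod int p)" unfolding H_def by blast
  then have "W 1 x (- u) y (z + u)" by (intro W_step) simp
  then have "W (1 + 1 + 1) 0 u 0 (- (z + u))"
    using W_trans[OF W_trans[OF W_from_zero] W_to_zero] by blast
  then show ?thesis by (simp add: algebra_simps numeral_3_eq_3)
qed

lemma W_alt_reach: "H.alt_reach k u v \<Longrightarrow> W (3 * k) 0 u 0 v"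
proof (induction k arbitrary: v)
  case 0
  then show ?case by (simp add: W_0)
next
  case (Suc k)
  then obtain z where z: "z \<in> H" "H.alt_reach k u (- v - z)" by auto
  then have "W (3 * k) 0 u 0 (- v - z)" using Suc.IH by blast
  moreover have "W 3 0 (- v - z) 0 (- (- v - z) - z)" using z by (intro W_3) (simp add: H.G0_def)
  ultimately have "W (3 * k + 3) 0 u 0 (- (- v - z) - z)" by (rule W_trans)
  then show ?case by (simp add: add.commute)
qed

text \<open>The second coordinates reached in \<open>3 * k\<close> steps form a set
  \<open>U k\<close> whose successor contains the reflection of \<open>U k + G0\<close>. Reflection
  preserves size, so Cauchy-Davenport adds \<open>t\<close> residues per round until all are
  reached.\<close>

lemma W_cauchy_davenport:
  assumes e: "p - 1 \<le> e * t"
  shows "W (3 * e) 0 u 0 v"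
proof -
  define U where "U k = {v \<in> {0..<int p}. W (3 * k) 0 u 0 v}" for k
  have p0: "int p > 0" using p_gt_1 by simp
  have fin: "finite (U k)" for k
    unfolding U_def by (rule finite_subset[of _ "{0..<int p}"]) auto
  have card_U: "min p (1 + k * t) \<le> card (U k)" for k
  proof (induction k)
    case 0
    have "u mod int p \<in> U 0" using p0 by (auto simp: U_def cong_def intro!: W_0)
    then have "card {u mod int p} \<le> card (U 0)" using fin by (intro card_mono) auto
    then show ?case by simp
  next
    case (Suc k)
    have "U k \<noteq> {}" using Suc p_gt_1 by auto
    moreover have "0 \<in> H.G0 \<inter> {0..<int p}" using H.zero_mem_G0 p0 by simp
    then have "H.G0 \<inter> {0..<int p} \<noteq> {}" by blast
    moreover have "U k \<subseteq> {0..<int p}" by (auto simp: U_def)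
    ultimately have "min p (card (U k) + card (H.G0 \<inter> {0..<int p}) - 1)
        \<le> card (sumset_mod (int p) (U k) (H.G0 \<inter> {0..<int p}))"
      using cauchy_davenport[OF prime_int_p, of "U k" "H.G0 \<inter> {0..<int p}"] by simp
    also have "\<dots> = card ((\<lambda>x. (- 1 * x + 0) mod int p) ` sumset_mod (int p) (U k) (H.G0 \<inter> {0..<int p}))"
    proof -
      have "inj_on (\<lambda>x. (- 1 * x + 0) mod int p) {0..<int p}" by (rule inj_on_residues_affine) simp
      moreover have "sumset_mod (int p) (U k) (H.G0 \<inter> {0..<int p}) \<subseteq> {0..<int p}"
        using p0 by (auto simp: sumset_mod_def)
      ultimately have "inj_on (\<lambda>x. (- 1 * x + 0) mod int p) (sumset_mod (int p) (U k) (H.G0 \<inter> {0..<int p}))"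
        by (rule inj_on_subset)
      then show ?thesis by (rule card_image[symmetric])
    qed
    also have "\<dots> \<le> card (U (Suc k))"
    proof (rule card_mono[OF fin])
      have "(- ((v + z) mod int p)) mod int p \<in> U (Suc k)" if "v \<in> U k" "z \<in> H.G0" for v z
      proof -
        have "W (3 * k + 3) 0 u 0 (- v - z)"
          using that W_3[of z v] by (intro W_trans[of "3 * k" 0 u 0 v]) (auto simp: U_def)
        moreover have "[- v - z = (- ((v + z) mod int p)) mod int p] (mod int p)"
          by (simp add: cong_def mod_minus_eq)
        ultimately show ?thesis using p0 W_cong_end by (auto simp: U_def add.commute)
      qed
      then show "(\<lambda>x. (- 1 * x + 0) mod int p) ` sumset_mod (int p) (U k) (H.G0 \<inter> {0..<int p}) \<subseteq> U (Suc k)"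
        by (auto elim!: sumset_modE)
    qed
    finally have "min p (card (U k) + t) \<le> card (U (Suc k))" by (simp add: H.card_G0)
    then show ?case using Suc by simp
  qed
  have "card {0..<int p} \<le> card (U e)" using card_U[of e] e p_gt_1 by simp
  then have "U e = {0..<int p}" by (intro card_seteq) (auto simp: U_def)
  moreover have "v mod int p \<in> {0..<int p}" using p0 by simp
  ultimately have "v mod int p \<in> U e" by blast
  then have "W (3 * e) 0 u 0 (v mod int p)" unfolding U_def by simp
  then show ?thesis by (rule W_cong_end) (simp add: cong_def)
qed

section \<open>Signed sums and distances\<close>

definition K :: "int set" where "K = {z. z \<in> H \<or> - z \<in> H}"

lemma K_subgroup: "symmetric_residue_subgroup (int p) K"
proof
  show "prime (int p)" by (rule prime_int_p)
  show "1 \<in> K" using H.one_mem by (simp add: K_def)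
  show "x * y \<in> K" if "x \<in> K" "y \<in> K" for x y
    using that H.mult_mem[of x y] H.mult_mem[of "- x" y] H.mult_mem[of x "- y"] H.mult_mem[of "- x" "- y"]
    by (auto simp: K_def)
  show "y \<in> K" if "x \<in> K" "[x = y] (mod int p)" for x y
    using that H.cong_mem[of x y] H.cong_mem[of "- x" "- y"] by (auto simp: K_def cong_minus_minus_iff)
  show "\<not> int p dvd x" if "x \<in> K" for x
    using that H.not_dvd[of x] H.not_dvd[of "- x"] by (auto simp: K_def)
  show "- x \<in> K" if "x \<in> K" for x
    using that by (auto simp: K_def)
qed

sublocale K: symmetric_residue_subgroup "int p" K by (rule K_subgroup)

text \<open>A sign flip after or before the three-step move of \<open>W_3\<close> adds
  \<open>z\<close> or subtracts \<open>- z\<close>, so both signs of elements of \<open>H\<close>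
  are available.\<close>

lemma W_4:
  assumes "z \<in> K.G0"
  shows "W 4 0 u 0 (u + z)"
proof -
  have "z \<in> K \<or> int p dvd z" using assms unfolding K.G0_def by simp
  then have "z \<in> H.G0 \<or> - z \<in> H.G0" by (auto simp: H.G0_def K_def)
  then show ?thesis
  proof
    assume "z \<in> H.G0"
    then have "W (3 + 1) 0 u 0 (- (- u - z))" by (intro W_trans[OF W_3 W_to_zero])
    then show ?thesis by (simp add: add.commute)
  next
    assume "- z \<in> H.G0"
    then have "W (1 + 3) 0 u 0 (- (- u) - (- z))" by (intro W_trans[OF W_to_zero W_3])
    then show ?thesis by simp
  qed
qed

lemma W_ksum: "c \<in> K.ksum k \<Longrightarrow> W (4 * k) 0 u 0 (u + c)"
proof (induction k arbitrary: c)
  case 0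
  then show ?case using W_0[of 0 0 u "u + c"] by (simp add: cong_iff_dvd_diff)
next
  case (Suc k)
  obtain y z where c: "c = y + z" "y \<in> K.ksum k" "z \<in> K.G0" using Suc.prems by (rule K.ksum_SucE)
  have "W (4 * k + 4) 0 u 0 (u + y + z)" using Suc.IH[OF c(2)] W_4[OF c(3)] by (rule W_trans)
  then show ?case using c(1) by (simp add: ac_simps)
qed

lemma W_ksum_UNIV:
  assumes "K.ksum k = UNIV"
  shows "W (4 * k) 0 u 0 v"
proof -
  have "W (4 * k) 0 u 0 (u + (v - u))" by (rule W_ksum) (simp only: assms UNIV_I)
  then show ?thesis by simp
qed

lemma walk_distance_le:
  assumes "W l x u y v"
  shows "digraph.walk_distance (x mod int p, u mod int p) (y mod int p, v mod int p) \<le> ereal (real l)"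
proof -
  obtain w where "digraph.awalk (x mod int p, u mod int p) w (y mod int p, v mod int p)" "length w = l"
    using assms unfolding W_def by blast
  then show ?thesis unfolding digraph.walk_distance_eq by (intro INF_lower2[of w]) auto
qed

lemma vertsE:
  assumes "a \<in> verts (with_proj (monomial_digraph p m n))"
  obtains x u where "a = (x mod int p, u mod int p)"
proof -
  obtain x u where "a = (x, u)" "x \<in> {0..int p - 1}" "u \<in> {0..int p - 1}"
    using assms by (auto simp: verts_monomial_digraph)
  then show ?thesis using that[of x u] by simp
qed

lemma diameter_le:
  assumes "\<And>x u y v. \<exists>l. real l \<le> N \<and> W l x u y v"
  shows "digraph.diameter \<le> ereal N"
  unfolding digraph.diameter_def
proof (rule SUP_least, clarify)
  fix a b c d assume "(a, b) \<in> verts (with_proj (monomial_digraph p m n))" "(c, d) \<in> verts (with_proj (monomial_digraph p m n))"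
  then obtain x u y v where xu: "(a, b) = (x mod int p, u mod int p)" "(c, d) = (y mod int p, v mod int p)"
    by (metis vertsE)
  obtain l where l: "real l \<le> N" "W l x u y v" using assms by blast
  have "digraph.walk_distance (a, b) (c, d) \<le> ereal (real l)"
    unfolding xu using l(2) by (rule walk_distance_le)
  also have "\<dots> \<le> ereal N" using l(1) by simp
  finally show "digraph.walk_distance (a, b) (c, d) \<le> ereal N" .
qed

lemma diameter_le_via_zero:
  assumes "\<And>u v. W l 0 u 0 v" "real l + 2 \<le> N"
  shows "digraph.diameter \<le> ereal N"
  using assms W_via_zero by (intro diameter_le exI[of _ "l + 2"]) auto

lemma diameter_ge:
  assumes "\<And>l. W l x u y v \<Longrightarrow> N \<le> real l"
  shows "ereal N \<le> digraph.diameter"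
proof -
  have "ereal N \<le> digraph.walk_distance (x mod int p, u mod int p) (y mod int p, v mod int p)"
    unfolding digraph.walk_distance_eq
  proof (rule INF_greatest)
    fix w assume "w \<in> {w. digraph.awalk (x mod int p, u mod int p) w (y mod int p, v mod int p)}"
    then have "W (length w) x u y v" by (auto simp: W_def)
    then show "ereal N \<le> ereal (real (length w))" using assms by simp
  qed
  also have "\<dots> \<le> digraph.diameter"
    unfolding digraph.diameter_def using mod_in_verts by (auto intro!: SUP_upper2)
  finally show ?thesis .
qed

lemma strongly_connected_monomial: "strongly_connected (with_proj (monomial_digraph p m n))"
  unfolding strongly_connected_def
proof (intro conjI ballI)
  show "verts (with_proj (monomial_digraph p m n)) \<noteq> {}" using mod_in_verts by blast
  fix a b assume "a \<in> verts (with_proj (monomial_digraph p m n))" "b \<in> verts (with_proj (monomial_digraph p m n))"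
  then obtain x u y v where ab: "a = (x mod int p, u mod int p)" "b = (y mod int p, v mod int p)"
    by (metis vertsE)
  have "W (3 * m + 2) x u y v" using index_le_m by (intro W_via_zero W_cauchy_davenport)
  then show "a \<rightarrow>\<^sup>*\<^bsub>with_proj (monomial_digraph p m n)\<^esub> b"
    unfolding ab W_def digraph.reachable_awalk by blast
qed

end

section \<open>Upper bounds for the diameter\<close>

lemma eighth_power_gt_fifth_power:
  fixes P x \<tau> :: real
  assumes x: "x \<ge> 5" and P: "P - 1 \<ge> x ^ 3" and \<tau>: "\<tau> \<ge> 0" "(x + 1) * \<tau> \<ge> P - 1"
  shows "P ^ 5 < \<tau> ^ 8"
proof -
  define y where "y = P - 1"
  have "(5::real) ^ 3 \<le> x ^ 3" using x by (intro power_mono) auto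
  then have y: "y \<ge> 125" "y \<ge> x ^ 3" using P by (simp_all add: y_def)
  have "P ^ 5 \<le> (126 / 125 * y) ^ 5" using y(1) by (intro power_mono) (auto simp: y_def)
  also have "\<dots> = (126 / 125) ^ 5 * y ^ 5" by (rule power_mult_distrib)
  also have "\<dots> \<le> 21 / 20 * y ^ 5" using y(1) by (intro mult_right_mono) (auto simp: eval_nat_numeral)
  finally have P5: "P ^ 5 \<le> 21 / 20 * y ^ 5" .
  \<comment> \<open>The inequality holds with constants to spare: replacing \<open>P\<close> by
    \<open>P - 1\<close> costs at most \<open>21 / 20\<close>, replacing \<open>x + 1\<close> by
    \<open>x\<close> at most \<open>43 / 10\<close>, and the factor 5 from \<open>x \<ge> 5\<close>
    exceeds their product.\<close>
  have "5 * x ^ 8 * y ^ 5 \<le> x ^ 9 * y ^ 5"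
  proof (rule mult_right_mono)
    have "x ^ 9 = x * x ^ 8" by (simp add: eval_nat_numeral)
    moreover have "5 * x ^ 8 \<le> x * x ^ 8" using x by (intro mult_right_mono) auto
    ultimately show "5 * x ^ 8 \<le> x ^ 9" by (simp only:)
  qed (use y in simp)
  also have "\<dots> = (x ^ 3) ^ 3 * y ^ 5" by (simp add: power_mult[symmetric])
  also have "\<dots> \<le> y ^ 3 * y ^ 5" using y x by (intro mult_right_mono power_mono) auto
  also have "\<dots> = y ^ 8" by (simp add: power_add[symmetric])
  also have "\<dots> \<le> ((x + 1) * \<tau>) ^ 8" using y \<tau> by (intro power_mono) (auto simp: y_def)
  also have "\<dots> \<le> (6 / 5 * x * \<tau>) ^ 8" using x \<tau> by (intro power_mono mult_right_mono) auto
  also have "\<dots> = (6 / 5) ^ 8 * x ^ 8 * \<tau> ^ 8" by (simp only: power_mult_distrib)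
  also have "\<dots> \<le> 43 / 10 * x ^ 8 * \<tau> ^ 8" using x \<tau> by (intro mult_right_mono) (auto simp: eval_nat_numeral)
  finally have "x ^ 8 * (5 * y ^ 5) \<le> x ^ 8 * (43 / 10 * \<tau> ^ 8)" by (simp add: ac_simps)
  then have "5 * y ^ 5 \<le> 43 / 10 * \<tau> ^ 8" by (rule mult_left_le_imp_le) (use x in simp)
  moreover have "y ^ 5 > 0" using y by simp
  ultimately show ?thesis using P5 by linarith
qed

lemma symmetric_residue:
  fixes c h :: int
  assumes "h \<ge> 0"
  obtains c' where "[c = c'] (mod (2 * h + 1))" "\<bar>c'\<bar> \<le> h"
proof
  define r where "r = (c + h) mod (2 * h + 1)"
  have "[c = (c + h) - h] (mod (2 * h + 1))" by simp
  also have "[(c + h) - h = r - h] (mod (2 * h + 1))"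
    unfolding r_def by (intro cong_diff) (auto simp: cong_def)
  finally show "[c = r - h] (mod (2 * h + 1))" .
  have "0 \<le> r" "r < 2 * h + 1" unfolding r_def using assms pos_mod_bound[of "2 * h + 1" "c + h"] by auto
  then show "\<bar>r - h\<bar> \<le> h" by linarith
qed

context monomial_params
begin

text \<open>Each summand costs four steps and the two ends one step each, so
  \<open>L \<le> 30 * sqrt m - 1 / 4\<close> becomes
  \<open>4 * L + 2 \<le> 120 * sqrt m + 1\<close>.\<close>

lemma diameter_le_sqrt:
  assumes "t \<ge> 3"
  shows "digraph.diameter \<le> ereal (120 * sqrt (real m) + 1)"
proof -
  define \<tau> where "\<tau> = card (K \<inter> {0..<int p})"
  have "t \<le> \<tau>" unfolding \<tau>_def by (intro card_mono) (auto simp: K_def)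
  then obtain L where L: "K.ksum L = UNIV"
    "real L \<le> 30 * sqrt (real_of_int (int p - 1) / \<tau>) - 1 / 4"
    using K.ksum_UNIV_sqrt assms unfolding \<tau>_def by (metis order.trans)
  have "p - 1 \<le> m * \<tau>" using index_le_m \<open>t \<le> \<tau>\<close> by (meson mult_le_mono2 order.trans)
  then have "real (p - 1) \<le> real (m * \<tau>)" by (simp only: of_nat_le_iff)
  then have "real_of_int (int p - 1) / \<tau> \<le> real m"
    using assms \<open>t \<le> \<tau>\<close> p_gt_1 by (simp add: field_simps of_nat_diff)
  then have "sqrt (real_of_int (int p - 1) / \<tau>) \<le> sqrt (real m)" by simp
  then have "4 * real L + 2 \<le> 120 * sqrt (real m) + 1" using L(2) by linarith
  then have "real (4 * L) + 2 \<le> 120 * sqrt (real m) + 1" by simp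
  then show ?thesis using W_ksum_UNIV[OF L(1)] by (intro diameter_le_via_zero)
qed

text \<open>At most five three-step moves and two end steps suffice: by Cauchy-Davenport for
  \<open>m \<le> 5\<close>, by convolution for larger \<open>m\<close>.\<close>

lemma diameter_le_19:
  assumes "real p > (real m - 1) ^ 3"
  shows "digraph.diameter \<le> ereal 19"
proof (cases "m \<le> 5")
  case True
  then show ?thesis using W_cauchy_davenport[OF index_le_m] by (intro diameter_le_via_zero[of "3 * m"]) auto
next
  case False
  have "real ((m - 1) ^ 3) < real p" using assms False by (simp add: of_nat_diff)
  then have "(m - 1) ^ 3 \<le> p - 1" by (simp only: of_nat_less_iff)
  then have "real ((m - 1) ^ 3) \<le> real (p - 1)" by (simp only: of_nat_le_iff)
  then have 1: "(real m - 1) ^ 3 \<le> real p - 1" using False p_gt_1 by (simp add: of_nat_diff)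
  have "real (p - 1) \<le> real (m * t)" using index_le_m by (simp only: of_nat_le_iff)
  then have "real p - 1 \<le> (real m - 1 + 1) * real t" using p_gt_1 by (simp add: of_nat_diff)
  then have "real p ^ 5 < real t ^ 8"
    using 1 False by (intro eighth_power_gt_fifth_power[of "real m - 1"]) auto
  then have "real (p ^ 5) < real (t ^ 8)" by simp
  then have "p ^ 5 < t ^ 8" by (simp only: of_nat_less_iff)
  then have "int (p ^ 5) < int (t ^ 8)" by (simp only: of_nat_less_iff)
  then have "H.alt_reach 5 u v" for u v by (intro H.alt_reach_5) simp
  then have "W (3 * 5) 0 u 0 v" for u v by (rule W_alt_reach)
  then show ?thesis by (intro diameter_le_via_zero) auto
qed

text \<open>When \<open>m = 1\<close> a first coordinate \<open>a\<close> enters the arc condition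
  linearly, so one intermediate vertex can be solved for to hit any target.\<close>

lemma W_4_linear:
  assumes "m = 1"
  shows "W 4 x u y v"
proof -
  define a where "a = y ^ n + u - v"
  have "W 1 a (- (- u)) 1 (a - u)" using assms by (intro W_step) simp
  moreover have "W 1 1 (a - u) y v" by (intro W_step) (simp add: a_def)
  ultimately have "W (1 + 1 + 1 + 1) x u y v"
    by (intro W_trans[OF W_trans[OF W_trans[OF W_to_zero W_from_zero]]])
  then show ?thesis by (simp add: eval_nat_numeral)
qed

text \<open>Outside the extremal case \<open>t \<ge> 2\<close>, so \<open>h = (p - 1) / 2\<close>
  summands suffice, and \<open>3 * h + 2 \<le> 4 * h\<close> once \<open>h \<ge> 2\<close>. Only
  \<open>p = 3\<close> escapes; there \<open>m = 1\<close>.\<close>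

lemma diameter_le_generic:
  assumes "n \<le> p - 1" "m \<le> n" and not_max: "\<not> (m = p - 1 \<and> n = p - 1)"
  shows "digraph.diameter \<le> ereal (2 * real p - 2)"
proof -
  have "t \<noteq> 1"
  proof
    assume "t = 1"
    then have "p - 1 dvd m" "p - 1 dvd n" using card_H_dvd by simp_all
    then have "p - 1 \<le> m" "p - 1 \<le> n" using m_pos n_pos by (auto dest: dvd_imp_le)
    then show False using assms by auto
  qed
  then have t2: "t \<ge> 2" using t_pos by linarith
  have "p \<noteq> 2" using assms m_pos by auto
  then have odd: "odd p" using prime_p primes_dvd_imp_eq two_is_prime_nat by blast
  show ?thesis
  proof (cases "p = 3")
    case True
    then have "m = 1" using assms m_pos by auto
    then show ?thesis using W_4_linear True by (intro diameter_le exI[of _ 4]) auto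
  next
    case False
    have p5: "p \<ge> 5" using odd False \<open>p \<noteq> 2\<close> p_gt_1 by presburger
    define h where "h = (p - 1) div 2"
    have h: "p - 1 = h * 2" using odd by (simp add: h_def)
    then have "p - 1 \<le> h * t" using t2 by simp
    then have "W (3 * h) 0 u 0 v" for u v by (rule W_cauchy_davenport)
    moreover have "3 * h + 2 \<le> 2 * p - 2" using h p5 by linarith
    then have "real (3 * h + 2) \<le> real (2 * p - 2)" by (simp only: of_nat_le_iff)
    then have "real (3 * h) + 2 \<le> 2 * real p - 2" using p5 by (simp add: of_nat_diff)
    ultimately show ?thesis by (intro diameter_le_via_zero)
  qed
qed

text \<open>If \<open>t\<close> is 1 or 2, then \<open>p - 1\<close> divides \<open>2 * m\<close>
  and \<open>2 * n\<close>, which confines both exponents to \<open>(p - 1) / 2\<close> and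
  \<open>p - 1\<close>; with \<open>m \<le> n\<close> only the excluded pairs remain.\<close>

lemma three_le_card_H:
  assumes "m \<le> n" "n \<le> p - 1" and ex: "(real m, real n) \<notin> {((real p - 1) / 2, (real p - 1) / 2),
    ((real p - 1) / 2, real p - 1), (real p - 1, real p - 1)}"
  shows "t \<ge> 3"
proof (rule ccontr)
  assume "\<not> t \<ge> 3"
  then have "t = 1 \<or> t = 2" using t_pos by linarith
  then have "t dvd 2" by (elim disjE) (simp_all only: one_dvd dvd_refl)
  then have dvd: "p - 1 dvd m * 2" "p - 1 dvd n * 2"
    using card_H_dvd by (meson dvd_trans mult_dvd_mono dvd_refl)+
  have *: "real k = (real p - 1) / 2 \<or> real k = real p - 1" if k: "p - 1 dvd k * 2" "1 \<le> k" "k \<le> p - 1" for k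
  proof -
    obtain c where c: "k * 2 = (p - 1) * c" using k(1) by blast
    then have "c \<noteq> 0" using k(2) by (intro notI) simp
    moreover have "c < 3"
    proof (rule ccontr)
      assume "\<not> c < 3"
      then have "(p - 1) * 3 \<le> k * 2" unfolding c by (intro mult_le_mono2) simp
      then show False using k by linarith
    qed
    ultimately have "k * 2 = p - 1 \<or> k = p - 1" using c by (auto simp: less_Suc_eq numeral_3_eq_3)
    then have "real (k * 2) = real (p - 1) \<or> real k = real (p - 1)" by (simp only: of_nat_eq_iff)
    then show ?thesis using p_gt_1 by (auto simp: of_nat_diff)
  qed
  have "real m \<le> real n" using assms(1) by simp
  then show False using *[OF dvd(1)] *[OF dvd(2)] ex assms m_pos n_pos p_gt_1 by auto
qed

lemma fermat_int:
  assumes "\<not> int p dvd x"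
  shows "[x ^ (p - 1) = 1] (mod int p)"
proof -
  obtain g :: int where g: "\<not> int p dvd g" "\<And>i. [g ^ i = 1] (mod int p) \<longleftrightarrow> nat (int p - 1) dvd i"
    "\<And>x. \<not> int p dvd x \<Longrightarrow> \<exists>i. [x = g ^ i] (mod int p)"
    using int_primitive_root[OF prime_int_p] by blast
  obtain i where "[x = g ^ i] (mod int p)" using g(3) assms by blast
  then have "[x ^ (p - 1) = (g ^ i) ^ (p - 1)] (mod int p)" by (rule cong_pow)
  also have "[(g ^ i) ^ (p - 1) = 1] (mod int p)"
  proof -
    have "nat (int p - 1) = p - 1" by simp
    then show ?thesis unfolding power_mult[symmetric] g(2) by simp
  qed
  finally show ?thesis .
qed

lemma W_shift: "W (4 * nat \<bar>c\<bar>) 0 u 0 (u + c)"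
  by (intro W_ksum K.int_mem_ksum)

text \<open>One three-step move with \<open>z = 1\<close> followed by \<open>k - 1\<close> four-step
  shifts by \<open>- 1\<close>.\<close>

lemma W_reflect_minus:
  assumes "k \<ge> 1"
  shows "W (4 * k - 1) 0 u 0 (- u - int k)"
proof -
  have "W 3 0 u 0 (- u - 1)" by (intro W_3 H.one_mem_G0)
  then have "W (3 + 4 * nat \<bar>- (int k - 1)\<bar>) 0 u 0 ((- u - 1) + - (int k - 1))"
    using W_shift by (rule W_trans)
  moreover have "3 + 4 * nat \<bar>- (int k - 1)\<bar> = 4 * k - 1" using assms by simp
  moreover have "(- u - 1) + - (int k - 1) = - u - int k" by simp
  ultimately show ?thesis by (simp only:)
qed

lemma W_reflect_plus: "W (4 * k + 1) 0 u 0 (int k - u)"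
proof -
  have "W (1 + 4 * nat \<bar>int k\<bar>) 0 u 0 (- u + int k)" using W_to_zero W_shift by (rule W_trans)
  then show ?thesis by (simp add: add.commute)
qed

end

section \<open>The extremal exponents\<close>

locale monomial_params_max = monomial_params +
  assumes m_max: "m = p - 1" and n_max: "n = p - 1"
begin

lemma cong_one:
  assumes "\<not> int p dvd x" "\<not> int p dvd y"
  shows "[x ^ m * y ^ n = 1] (mod int p)"
  using cong_mult[OF fermat_int[OF assms(1)] fermat_int[OF assms(2)]] by (simp add: m_max n_max)

lemma W_unit: "\<not> int p dvd x \<Longrightarrow> \<not> int p dvd y \<Longrightarrow> W 1 x u y (1 - u)"
  using cong_one by (intro W_step) (simp add: cong_sym)

text \<open>Two routes compete: shifting by the symmetric residue \<open>c\<close> of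
  \<open>v - u\<close> costs \<open>4 * \<bar>c\<bar>\<close>, and reflecting with the symmetric
  residue \<open>s\<close> of \<open>v + u\<close> costs \<open>4 * \<bar>s\<bar> - 1\<close> or
  \<open>4 * s + 1\<close> according to the sign of \<open>s\<close>. Both exceed
  \<open>4 * h - 1\<close> only if \<open>\<bar>c\<bar> = h\<close> and \<open>s = h\<close>, which
  determines \<open>u\<close> and \<open>v\<close>.\<close>

lemma W_0_0:
  assumes h: "p = 2 * h + 1"
  shows "(\<exists>l \<le> 4 * h - 1. W l 0 u 0 v) \<or>
    (\<exists>l \<le> 4 * h. W l 0 u 0 v) \<and>
      ([u = 0] (mod int p) \<and> [v = int h] (mod int p) \<or> [u = int h] (mod int p) \<and> [v = 0] (mod int p))"
proof -
  have p: "int p = 2 * int h + 1" using h by simp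
  have h1: "h \<ge> 1" using h p_gt_1 by simp
  obtain c where c: "[v - u = c] (mod int p)" "\<bar>c\<bar> \<le> int h"
    using symmetric_residue[of "int h" "v - u"] unfolding p by auto
  obtain s where s: "[v + u = s] (mod int p)" "\<bar>s\<bar> \<le> int h"
    using symmetric_residue[of "int h" "v + u"] unfolding p by auto
  have Wc: "W (4 * nat \<bar>c\<bar>) 0 u 0 v"
  proof (rule W_cong_end[OF W_shift])
    show "[u + c = v] (mod int p)" using c(1) by (simp add: cong_iff_dvd_diff algebra_simps dvd_diff_commute)
  qed
  consider "\<bar>c\<bar> < int h" | "s < 0" | "0 \<le> s" "s < int h" | "\<bar>c\<bar> = int h" "s = int h" using c s by linarith
  then show ?thesis
  proof cases
    case 1
    then have "4 * nat \<bar>c\<bar> \<le> 4 * h - 1" by linarith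
    then show ?thesis using Wc by blast
  next
    case 2
    have "W (4 * nat (- s) - 1) 0 u 0 (- u - int (nat (- s)))" using 2 by (intro W_reflect_minus) simp
    then have "W (4 * nat (- s) - 1) 0 u 0 v"
      by (rule W_cong_end) (use 2 s(1) in \<open>simp add: cong_iff_dvd_diff algebra_simps dvd_diff_commute\<close>)
    moreover have "4 * nat (- s) - 1 \<le> 4 * h - 1" using 2 s(2) by linarith
    ultimately show ?thesis by blast
  next
    case 3
    have "W (4 * nat s + 1) 0 u 0 (int (nat s) - u)" by (rule W_reflect_plus)
    then have "W (4 * nat s + 1) 0 u 0 v"
      by (rule W_cong_end) (use 3 s(1) in \<open>simp add: cong_iff_dvd_diff algebra_simps dvd_diff_commute\<close>)
    moreover have "4 * nat s + 1 \<le> 4 * h - 1" using 3 by linarith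
    ultimately show ?thesis by blast
  next
    case 4
    have "\<exists>l \<le> 4 * h. W l 0 u 0 v" using Wc 4(1) by (intro exI[of _ "4 * nat \<bar>c\<bar>"]) simp
    have d1: "int p dvd v - u - c" and d2: "int p dvd v + u - int h"
      using c(1) s(1) 4(2) by (simp_all add: cong_iff_dvd_diff)
    have two: "int p dvd z" if "int p dvd 2 * z" for z
    proof -
      have "coprime (int p) 2" unfolding p by simp
      then show ?thesis using that coprime_dvd_mult_right_iff by blast
    qed
    have "c = int h \<or> c = - int h" using 4(1) by linarith
    then have "[u = 0] (mod int p) \<and> [v = int h] (mod int p) \<or> [u = int h] (mod int p) \<and> [v = 0] (mod int p)"
    proof
      assume "c = int h"
      then have "int p dvd 2 * u" "int p dvd 2 * (v - int h)"
        using dvd_diff[OF d2 d1] dvd_add[OF d2 d1] by (simp_all add: algebra_simps)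
      from this[THEN two] have "int p dvd u" "int p dvd v - int h" .
      then show ?thesis by (simp add: cong_iff_dvd_diff)
    next
      assume "c = - int h"
      then have "int p dvd 2 * (u - int h)" "int p dvd 2 * v"
        using dvd_diff[OF d2 d1] dvd_add[OF d2 d1] by (simp_all add: algebra_simps)
      from this[THEN two] have "int p dvd u - int h" "int p dvd v" .
      then show ?thesis by (simp add: cong_iff_dvd_diff)
    qed
    then show ?thesis using \<open>\<exists>l \<le> 4 * h. W l 0 u 0 v\<close> by blast
  qed
qed

text \<open>Entering and leaving first coordinate 0 costs two steps, or one if an endpoint is
  already there. Only the exceptional pairs of \<open>W_0_0\<close> with both first coordinates
  nonzero need another route.\<close>

lemma upper_odd:
  assumes h: "p = 2 * h + 1"
  shows "\<exists>l \<le> 4 * h + 1. W l x u y v"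
proof -
  have p: "int p = 2 * int h + 1" using h by simp
  have h1: "h \<ge> 1" using h p_gt_1 by simp
  have le: "\<exists>l \<le> 4 * h. W l 0 u 0 v" for u v
    using W_0_0[OF h, of u v] by (meson diff_le_self order.trans)
  have dvd1: "\<not> int p dvd 1" using p_gt_1 by simp
  consider "int p dvd x" | "int p dvd y" | "\<exists>l \<le> 4 * h - 1. W l 0 (- u) 0 (- v)"
    | "\<not> int p dvd x" "\<not> int p dvd y" "[- u = 0] (mod int p)" "[- v = int h] (mod int p)"
    | "\<not> int p dvd x" "\<not> int p dvd y" "[- u = int h] (mod int p)" "[- v = 0] (mod int p)"
    using W_0_0[OF h, of "- u" "- v"] by blast
  then show ?thesis
  proof cases
    case 1
    obtain l where l: "l \<le> 4 * h" "W l 0 u 0 (- v)" using le by blast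
    have "W (l + 1) 0 u y (- (- v))" using l(2) W_from_zero by (rule W_trans)
    then have "W (l + 1) x u y v" using W_cong[of x 0 u u y y v v "l + 1"] 1 by (simp add: cong_iff_dvd_diff)
    then show ?thesis using l(1) by (intro exI[of _ "l + 1"]) simp
  next
    case 2
    obtain l where l: "l \<le> 4 * h" "W l 0 (- u) 0 v" using le by blast
    have "W (1 + l) x u 0 v" using W_to_zero l(2) by (rule W_trans)
    then have "W (1 + l) x u y v" using W_cong[of x x u u y 0 v v "1 + l"] 2 by (simp add: cong_iff_dvd_diff)
    then show ?thesis using l(1) by (intro exI[of _ "1 + l"]) simp
  next
    case 3
    then obtain l where "l \<le> 4 * h - 1" "W l 0 (- u) 0 (- v)" by blast
    then show ?thesis using W_via_zero h1 by (intro exI[of _ "l + 2"]) auto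
  next
    case 4
    \<comment> \<open>Starting with an arc of value 1 lowers the reflection that follows from
      \<open>h\<close> to \<open>h - 1\<close>; the whole walk has length
      \<open>4 * h\<close>.\<close>
    have "W (1 + 1) x u 0 (- (1 - u))" using W_unit[OF 4(1) dvd1] W_to_zero by (rule W_trans)
    then have "W (1 + 1 + (4 * (h - 1) + 1)) x u 0 (int (h - 1) - (- (1 - u)))"
      using W_reflect_plus by (rule W_trans)
    then have "W (1 + 1 + (4 * (h - 1) + 1) + 1) x u y (- (int (h - 1) - (- (1 - u))))"
      using W_from_zero by (rule W_trans)
    then have "W (1 + 1 + (4 * (h - 1) + 1) + 1) x u y v"
    proof (rule W_cong_end)
      show "[- (int (h - 1) - (- (1 - u))) = v] (mod int p)"
      proof -
        have d1: "int p dvd - u" and d2: "int p dvd - v - int h" using 4(3,4) by (simp_all only: cong_iff_dvd_diff diff_0_right)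
        have "int p dvd (- v - int h) - (- u)" using d2 d1 by (rule dvd_diff)
        then show ?thesis using h1 by (simp add: cong_iff_dvd_diff of_nat_diff algebra_simps)
      qed
    qed
    then show ?thesis using h1 by (intro exI[of _ "1 + 1 + (4 * (h - 1) + 1) + 1"]) simp
  next
    case 5
    \<comment> \<open>The mirror image: the arc of value 1 comes last, leaving from first coordinate
      1.\<close>
    have "W (1 + (4 * (h - 1) + 1)) x u 0 (int (h - 1) - (- u))"
      using W_to_zero W_reflect_plus by (rule W_trans)
    then have "W (1 + (4 * (h - 1) + 1) + 1) x u 1 (- (int (h - 1) - (- u)))"
      using W_from_zero by (rule W_trans)
    then have "W (1 + (4 * (h - 1) + 1) + 1 + 1) x u y (1 - - (int (h - 1) - (- u)))"
      using W_unit[OF dvd1 5(2)] by (rule W_trans)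
    then have "W (1 + (4 * (h - 1) + 1) + 1 + 1) x u y v"
    proof (rule W_cong_end)
      have d1: "int p dvd - u - int h" and d2: "int p dvd - v" using 5(3,4) by (simp_all only: cong_iff_dvd_diff diff_0_right)
      have "int p dvd (- v) - (- u - int h)" using d2 d1 by (rule dvd_diff)
      then show "[1 - - (int (h - 1) - (- u)) = v] (mod int p)"
        using h1 by (simp add: cong_iff_dvd_diff of_nat_diff algebra_simps)
    qed
    then show ?thesis using h1 by (intro exI[of _ "1 + (4 * (h - 1) + 1) + 1 + 1"]) simp
  qed
qed

lemma upper_two:
  assumes p2: "p = 2"
  shows "\<exists>l \<le> 3. W l x u y v"
proof -
  have ex: "\<exists>l \<le> 3. W l x u y v" if "W l x u y v'" "l \<le> 3" "even (v' - v)" for l v'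
    using that W_cong_end[of l x u y v' v] by (auto simp: p2 cong_iff_dvd_diff)
  have W1: "W l 0 u y v \<Longrightarrow> even x \<Longrightarrow> W l x u y v" for l x u y v
    using W_cong[of x 0 u u y y v v l] by (simp add: p2 cong_iff_dvd_diff)
  have W2: "W l x u 0 v \<Longrightarrow> even y \<Longrightarrow> W l x u y v" for l x u y v
    using W_cong[of x x u u y 0 v v l] by (simp add: p2 cong_iff_dvd_diff)
  have unit: "odd a \<Longrightarrow> odd b \<Longrightarrow> W 1 a c b (1 - c)" for a b c using W_unit by (simp add: p2)
  show ?thesis
  proof (cases "even x"; cases "even y"; cases "even (u - v)")
    assume *: "even x" "even y" "even (u - v)"
    have "W 0 x u y u" using * by (intro W_0) (simp_all add: p2 cong_iff_dvd_diff)
    then show ?thesis by (rule ex) (use * in simp_all)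
  next
    assume *: "even x" "even y" "odd (u - v)"
    have "W 3 0 u 0 (- u - 1)" by (intro W_3 H.one_mem_G0)
    then have "W 3 x u y (- u - 1)" using W1[OF W2] * by blast
    then show ?thesis by (rule ex) (use * in simp_all)
  next
    assume *: "even x" "odd y" "even (u - v)"
    have "W 1 x u y (- u)" using W1[OF W_from_zero] * by blast
    then show ?thesis by (rule ex) (use * in simp_all)
  next
    assume *: "even x" "odd y" "odd (u - v)"
    have "W (1 + 1) 0 u y (1 - - u)" using W_from_zero unit[OF odd_one *(2)] by (rule W_trans)
    then have "W (1 + 1) x u y (1 - - u)" using W1 * by blast
    then show ?thesis by (rule ex) (use * in simp_all)
  next
    assume *: "odd x" "even y" "even (u - v)"
    have "W 1 x u y (- u)" using W2[OF W_to_zero] * by blast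
    then show ?thesis by (rule ex) (use * in simp_all)
  next
    assume *: "odd x" "even y" "odd (u - v)"
    have "W (1 + 1) x u 0 (- (1 - u))" using unit[OF *(1) odd_one] W_to_zero by (rule W_trans)
    then have "W (1 + 1) x u y (- (1 - u))" using W2 * by blast
    then show ?thesis by (rule ex) (use * in simp_all)
  next
    assume *: "odd x" "odd y" "even (u - v)"
    have "W 0 x u y u" using * by (intro W_0) (simp_all add: p2 cong_iff_dvd_diff)
    then show ?thesis by (rule ex) (use * in simp_all)
  next
    assume *: "odd x" "odd y" "odd (u - v)"
    then have "W 1 x u y (1 - u)" by (intro unit)
    then show ?thesis by (rule ex) (use * in simp_all)
  qed
qed

text \<open>The second coordinate reached from \<open>(0, 0)\<close> lifts to an integer that grows by at most one
  in four steps.\<close>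

lemma awalk_lift_bound:
  assumes "digraph.awalk (0, 0) w (y, v)"
  shows "\<exists>s. [v = s] (mod int p) \<and>
    (if y = 0 then - (int (length w) + 1) \<le> 4 * s \<and> 4 * s \<le> int (length w)
     else - (int (length w) - 1) \<le> 4 * s \<and> 4 * s \<le> int (length w) + 2)"
  using assms
proof (induction w arbitrary: y v rule: rev_induct)
  case Nil
  then show ?case by (auto simp: digraph.awalk_Nil_iff intro!: exI[of _ 0])
next
  case (snoc e w)
  obtain y' v' where aw: "digraph.awalk (0, 0) w (y', v')" and arc: "((y', v'), (y, v)) \<in> parcs (monomial_digraph p m n)"
    using snoc.prems by (cases e; cases "fst e") (auto simp: digraph.awalk_simps)
  have range: "y' \<in> {0..int p - 1}" "v' \<in> {0..int p - 1}" "y \<in> {0..int p - 1}" "v \<in> {0..int p - 1}"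
    using digraph.wellformed[of "((y', v'), (y, v))"] arc by (auto simp: verts_monomial_digraph)
  then have eq: "[v' + v = y' ^ m * y ^ n] (mod int p)"
    using arc arc_monomial_digraph_iff[OF p_gt_1, of y' v' m n y v] by (simp add: verts_monomial_digraph)
  obtain s where s: "[v' = s] (mod int p)" and bounds:
    "if y' = 0 then - (int (length w) + 1) \<le> 4 * s \<and> 4 * s \<le> int (length w)
     else - (int (length w) - 1) \<le> 4 * s \<and> 4 * s \<le> int (length w) + 2"
    using snoc.IH[OF aw] by blast
  have nd: "\<not> int p dvd z" if "z \<in> {0..int p - 1}" "z \<noteq> 0" for z
    using that zdvd_imp_le[of "int p" z] by auto
  \<comment> \<open>The second coordinates along an arc sum to 1 if both first coordinates are
    nonzero, else to 0. The two ranges for \<open>s\<close> are matched so that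
    \<open>\<epsilon> - s\<close> obeys the range for one more step.\<close>
  define \<epsilon> :: int where "\<epsilon> = (if y' = 0 \<or> y = 0 then 0 else 1)"
  have "[v' + v = \<epsilon>] (mod int p)"
  proof (cases "y' = 0 \<or> y = 0")
    case True
    then show ?thesis using eq m_pos n_pos by (auto simp: \<epsilon>_def power_0_left)
  next
    case False
    then have "[y' ^ m * y ^ n = 1] (mod int p)" using range nd by (intro cong_one) auto
    then show ?thesis using eq False by (auto simp: \<epsilon>_def intro: cong_trans)
  qed
  then have "[(v' + v) - v' = \<epsilon> - s] (mod int p)" using s by (rule cong_diff)
  then have "[v = \<epsilon> - s] (mod int p)" by simp
  moreover have "if y = 0 then - (int (length (w @ [e])) + 1) \<le> 4 * (\<epsilon> - s) \<and> 4 * (\<epsilon> - s) \<le> int (length (w @ [e]))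
     else - (int (length (w @ [e])) - 1) \<le> 4 * (\<epsilon> - s) \<and> 4 * (\<epsilon> - s) \<le> int (length (w @ [e])) + 2"
    using bounds by (cases "y = 0"; cases "y' = 0") (auto simp: \<epsilon>_def)
  ultimately show ?case by blast
qed

lemma diameter_max: "digraph.diameter = ereal (2 * real p - 1)"
proof (rule antisym)
  consider "p = 2" | h where "p = 2 * h + 1"
    using prime_p primes_dvd_imp_eq two_is_prime_nat by (metis oddE)
  then show "digraph.diameter \<le> ereal (2 * real p - 1)"
  proof cases
    case 1
    then have "\<exists>l. real l \<le> 2 * real p - 1 \<and> W l x u y v" for x u y v using upper_two[OF 1, of x u y v] by auto
    then show ?thesis by (rule diameter_le)
  next
    case 2
    have "\<exists>l. real l \<le> 2 * real p - 1 \<and> W l x u y v" for x u y v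
    proof -
      obtain l where "l \<le> 4 * h + 1" "W l x u y v" using upper_odd[OF 2] by blast
      then show ?thesis using 2 by (intro exI[of _ l]) simp
    qed
    then show ?thesis by (rule diameter_le)
  qed
  consider "p = 2" | h where "p = 2 * h + 1"
    using prime_p primes_dvd_imp_eq two_is_prime_nat by (metis oddE)
  then show "ereal (2 * real p - 1) \<le> digraph.diameter"
  proof cases
    case 1
    show ?thesis
    proof (rule diameter_ge[of 0 0 0 1])
      fix l assume "W l 0 0 0 1"
      moreover have "1 mod int p = 1" using p_gt_1 by simp
      ultimately obtain w where w: "digraph.awalk (0, 0) w (0, 1)" "length w = l" unfolding W_def by auto
      obtain s where "[1 = s] (mod int p)" "- (int l + 1) \<le> 4 * s" "4 * s \<le> int l"
        using awalk_lift_bound[OF w(1)] w(2) by auto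
      moreover from this have "odd s" by (auto simp: 1 cong_iff_dvd_diff)
      ultimately have "l \<ge> 3" by presburger
      then show "2 * real p - 1 \<le> real l" using 1 by simp
    qed
  next
    case 2
    then have p: "int p = 2 * int h + 1" and h1: "h \<ge> 1" using p_gt_1 by auto
    show ?thesis
    \<comment> \<open>The target residue has the lifts \<open>h + 1\<close> and \<open>- h\<close>
      nearest to 0; the asymmetric bounds for nonzero first coordinate make both cost at least
      \<open>4 * h + 1\<close> steps.\<close>
    proof (rule diameter_ge[of 0 0 1 "int h + 1"])
      fix l assume "W l 0 0 1 (int h + 1)"
      moreover have "1 mod int p = 1" "(int h + 1) mod int p = int h + 1" using p h1 by simp_all
      ultimately obtain w where w: "digraph.awalk (0, 0) w (1, int h + 1)" "length w = l"
        unfolding W_def by auto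
      obtain s where s: "[int h + 1 = s] (mod int p)" "- (int l - 1) \<le> 4 * s" "4 * s \<le> int l + 2"
        using awalk_lift_bound[OF w(1)] w(2) by auto
      have "int p dvd s - (int h + 1)" using s(1) by (simp add: cong_iff_dvd_diff dvd_diff_commute)
      then obtain k where k: "s - (int h + 1) = int p * k" by blast
      have "l \<ge> 4 * h + 1"
      proof (cases "k \<ge> 0")
        case True
        then have "int p * k \<ge> 0" by simp
        then show ?thesis using k s by linarith
      next
        case False
        then have "int p * k \<le> int p * (- 1)" by (intro mult_left_mono) auto
        then show ?thesis using k s p by linarith
      qed
      then have "real l \<ge> real (4 * h + 1)" by (simp only: of_nat_le_iff)
      then show "2 * real p - 1 \<le> real l" using 2 by simp
    qed
  qed
qed

end

theorem theorem1p1p2: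
  fixes p m n :: nat
  assumes "prime p" and "1 \<le> m" and "m \<le> n" and "n \<le> p - 1"
  shows "strongly_connected (with_proj (monomial_digraph p m n)) \<and>
    (wf_digraph.diameter (with_proj (monomial_digraph p m n)) \<le> ereal (2 * real p - 1) \<and>
      (wf_digraph.diameter (with_proj (monomial_digraph p m n)) = ereal (2 * real p - 1) \<longleftrightarrow>
        m = p - 1 \<and> n = p - 1)) \<and>
    ((real m, real n) \<notin> {((real p - 1) / 2, (real p - 1) / 2),
                          ((real p - 1) / 2, real p - 1),
                          (real p - 1, real p - 1)} \<longrightarrow>
      wf_digraph.diameter (with_proj (monomial_digraph p m n)) \<le> ereal (120 * sqrt (real m) + 1)) \<and>
    (real p > (real m - 1) ^ 3 \<longrightarrow>
      wf_digraph.diameter (with_proj (monomial_digraph p m n)) \<le> 19)"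
proof -
  interpret monomial_params p m n using assms by unfold_locales auto
  have "digraph.diameter \<le> ereal (2 * real p - 1) \<and>
      (digraph.diameter = ereal (2 * real p - 1) \<longleftrightarrow> m = p - 1 \<and> n = p - 1)"
  proof (cases "m = p - 1 \<and> n = p - 1")
    case True
    then interpret monomial_params_max p m n by unfold_locales auto
    show ?thesis using True diameter_max by simp
  next
    case False
    have "digraph.diameter \<le> ereal (2 * real p - 2)" using assms False by (intro diameter_le_generic)
    also have "\<dots> < ereal (2 * real p - 1)" by simp
    finally show ?thesis using False by auto
  qed
  moreover have "digraph.diameter \<le> ereal 19" if "real p > (real m - 1) ^ 3"
    using that by (rule diameter_le_19)
  moreover have "ereal 19 = 19" by simp
  ultimately show ?thesis
    using strongly_connected_monomial three_le_card_H[OF assms(3,4)] diameter_le_sqrt by metis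
qed

end
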